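(* Let $K$ be a totally real number field of degree $d$ over $\mathbb{Q}$ with ring of integers $\mathcal{O}_K$ and discriminant $\Delta_K$. Let $n>d$ be an integer and let $\boldsymbol\alpha=(\alpha_1,\dots,\alpha_n)$ be an $n$-tuple of nonzero elements of $\mathcal{O}_K^+$ such that $\mathcal{O}_K=\operatorname{span}_{\mathbb{Z}}\{\alpha_1,\dots,\alpha_n\}$. Assume that $\operatorname{Sg}(\boldsymbol\alpha)\ne\mathcal{C}_{\mathbb{Q}}(\boldsymbol\alpha)\cap\mathcal{O}_K$. Then $$H(\boldsymbol\alpha)\ge\left(\frac{2\,|\Delta_K|\,\sqrt{n-d+1}\;(n-d-1)!}{d!\,n!}\right)^{1/(2d)}.$$
   Context: Let $\sigma_1,\dots,\sigma_d:K\to\mathbb{R}$ be the embeddings of $K$. Put $\mathcal{O}_K^+=\{\alpha\in\mathcal{O}_K:\sigma_i(\alpha)\ge 0 \text{ for all } 1\le i\le d\}$, $\operatorname{Sg}(\boldsymbol\alpha)=\{\sum_{i=1}^n\alpha_ix_i:\boldsymbol x\in\mathbb{Z}_{\ge 0}^n\}$ and $\mathcal{C}_{\mathbb{Q}}(\boldsymbol\alpha)=\{\sum_{i=1}^n\alpha_ix_i:\boldsymbol x\in\mathbb{Q}_{\ge 0}^n\}$. Let $M(K)$ be the set of places of $K$ and $d_v=[K_v:\mathbb{Q}_v]$ the local degree at $v$. Absolute values are normalized so that the product formula reads $\prod_{v\in M(K)}|a|_v=1$ for all nonzero $a\in K$, i.e. $|\cdot|_v$ is the $d_v$-th power of the absolute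 value extending the usual (real or $p$-adic) one on $\mathbb{Q}$. The inhomogeneous height is $H_K(\boldsymbol\alpha)=\prod_{v\in M(K)}\max\{1,|\alpha_1|_v,\dots,|\alpha_n|_v\}$ and the absolute Weil height is $H(\boldsymbol\alpha)=H_K(\boldsymbol\alpha)^{1/d}$. *)

theory Defs
  imports
    Complex_Main
    "HOL-Computational_Algebra.Computational_Algebra"
    "HOL-Algebra.Embedded_Algebras"
    "HOL-Algebra.QuotRing"
    "Jordan_Normal_Form.Determinant"
begin

section \<open>Number fields\<close>

definition number_field :: "'k::field_char_0 itself \<Rightarrow> bool" where
  "number_field _ \<longleftrightarrow>
     (\<exists>B :: 'k set. finite B \<and> module.span (\<lambda>(q::rat) (x::'k). of_rat q * x) B = UNIV)"

definition field_degree :: "'k::field_char_0 itself \<Rightarrow> nat" where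
  "field_degree _ = vector_space.dim (\<lambda>(q::rat) (x::'k). of_rat q * x) UNIV"

definition field_embeddings :: "('k::field \<Rightarrow> 'l::field) set" where
  "field_embeddings =
     {\<sigma>. \<sigma> 1 = 1 \<and> (\<forall>x y. \<sigma> (x + y) = \<sigma> x + \<sigma> y) \<and> (\<forall>x y. \<sigma> (x * y) = \<sigma> x * \<sigma> y)}"

definition totally_real :: "'k::field_char_0 itself \<Rightarrow> bool" where
  "totally_real _ \<longleftrightarrow> (\<forall>\<sigma> \<in> (field_embeddings :: ('k \<Rightarrow> complex) set). range \<sigma> \<subseteq> \<real>)"

definition ring_of_integers :: "'k::field_char_0 set" where
  "ring_of_integers = {x. algebraic_int x}"

definition nonneg_integers :: "'k::field_char_0 set" where
  "nonneg_integers =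
     {x \<in> ring_of_integers. \<forall>\<sigma> \<in> (field_embeddings :: ('k \<Rightarrow> real) set). \<sigma> x \<ge> 0}"

definition int_span :: "'i set \<Rightarrow> ('i \<Rightarrow> 'k::field_char_0) \<Rightarrow> 'k set" where
  "int_span I a = {(\<Sum>i\<in>I. a i * of_int (x i)) | x :: 'i \<Rightarrow> int. True}"

definition integral_basis :: "(nat \<Rightarrow> 'k::field_char_0) \<Rightarrow> bool" where
  "integral_basis w \<longleftrightarrow>
     int_span {..<field_degree TYPE('k)} w = ring_of_integers \<and>
     (\<forall>c :: nat \<Rightarrow> int. (\<Sum>j<field_degree TYPE('k). w j * of_int (c j)) = 0
        \<longrightarrow> (\<forall>j<field_degree TYPE('k). c j = 0))"

text \<open>
  The discriminant is \<open>det (\<sigma>\<^sub>i (w\<^sub>j))\<^sup>2\<close> for the complex embeddings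
  \<open>\<sigma>\<^sub>1, \<dots>, \<sigma>\<^sub>d\<close> and an integral basis \<open>w\<close>.  It depends neither on the
  order of the embeddings nor on the basis, so both may be chosen arbitrarily.  Its value is a
  rational integer, represented here as a complex number.
\<close>

definition discriminant :: "'k::field_char_0 itself \<Rightarrow> complex" where
  "discriminant _ =
     (let d = field_degree TYPE('k);
          \<sigma>s = (SOME \<sigma>s. distinct \<sigma>s \<and> set \<sigma>s = (field_embeddings :: ('k \<Rightarrow> complex) set));
          w = (SOME w :: nat \<Rightarrow> 'k. integral_basis w)
      in (det (mat d d (\<lambda>(i, j). (\<sigma>s ! i) (w j))))\<^sup>2)"


section \<open>Places and local degrees\<close>

definition absolute_value :: "('k::field \<Rightarrow> real) \<Rightarrow> bool" where
  "absolute_value v \<longleftrightarrow>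
     (\<forall>x. v x \<ge> 0) \<and> (\<forall>x. v x = 0 \<longleftrightarrow> x = 0) \<and>
     (\<forall>x y. v (x * y) = v x * v y) \<and> (\<forall>x y. v (x + y) \<le> v x + v y)"

definition padic_abs :: "nat \<Rightarrow> rat \<Rightarrow> real" where
  "padic_abs p q =
     (if q = 0 then 0
      else (case quotient_of q of (a, b) \<Rightarrow>
        real p powi (int (multiplicity (int p) b) - int (multiplicity (int p) a))))"

text \<open>
  By Ostrowski's theorem, every equivalence class of nontrivial absolute values on a number field
  contains exactly one absolute value extending the usual absolute value or a \<open>p\<close>-adic one on
  the rationals.  A place is represented by this member of its class.
\<close>

definition places :: "('k::field_char_0 \<Rightarrow> real) set" where
  "places = {v. absolute_value v \<and>
     ((\<forall>q. v (of_rat q) = \<bar>real_of_rat q\<bar>) \<or>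
      (\<exists>p. prime p \<and> (\<forall>q. v (of_rat q) = padic_abs p q)))}"

text \<open>
  The completion at \<open>v\<close> is the ring of \<open>v\<close>-Cauchy sequences modulo the ideal of
  null sequences; the completion of the rationals at the place below \<open>v\<close> is identified
  with its subfield of classes of rational Cauchy sequences.
\<close>

definition cauchy_ring :: "('k::field \<Rightarrow> real) \<Rightarrow> (nat \<Rightarrow> 'k) ring" where
  "cauchy_ring v =
     \<lparr> carrier = {s. \<forall>e>0. \<exists>N. \<forall>m\<ge>N. \<forall>n\<ge>N. v (s m - s n) < e},
       mult = (\<lambda>s t n. s n * t n), one = (\<lambda>_. 1),
       zero = (\<lambda>_. 0), add = (\<lambda>s t n. s n + t n) \<rparr>"

definition null_sequences :: "('k::field \<Rightarrow> real) \<Rightarrow> (nat \<Rightarrow> 'k) set" where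
  "null_sequences v = {s. (\<lambda>n. v (s n)) \<longlonglongrightarrow> 0}"

definition completion :: "('k::field \<Rightarrow> real) \<Rightarrow> (nat \<Rightarrow> 'k) set ring" where
  "completion v = cauchy_ring v Quot null_sequences v"

definition rat_completion :: "('k::field_char_0 \<Rightarrow> real) \<Rightarrow> (nat \<Rightarrow> 'k) set set" where
  "rat_completion v =
     {null_sequences v +>\<^bsub>cauchy_ring v\<^esub> s | s. s \<in> carrier (cauchy_ring v) \<and> range s \<subseteq> \<rat>}"

definition local_degree :: "('k::field_char_0 \<Rightarrow> real) \<Rightarrow> nat" where
  "local_degree v = ring.dim (completion v) (rat_completion v) (carrier (completion v))"

definition normalized_abs :: "('k::field_char_0 \<Rightarrow> real) \<Rightarrow> 'k \<Rightarrow> real" where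
  "normalized_abs v x = v x ^ local_degree v"


section \<open>Heights\<close>

definition local_height :: "('k::field_char_0 \<Rightarrow> real) \<Rightarrow> nat \<Rightarrow> (nat \<Rightarrow> 'k) \<Rightarrow> real" where
  "local_height v n a = Max (insert 1 ((\<lambda>i. normalized_abs v (a i)) ` {1..n}))"

text \<open>
  All but finitely many local factors are \<open>1\<close>; since \<^const>\<open>prod\<close> is trivial over
  infinite index sets, the product is restricted to the other ones.
\<close>

definition field_height :: "nat \<Rightarrow> (nat \<Rightarrow> 'k::field_char_0) \<Rightarrow> real" where
  "field_height n a = (\<Prod>v \<in> {v \<in> places. local_height v n a \<noteq> 1}. local_height v n a)"

definition weil_height :: "nat \<Rightarrow> (nat \<Rightarrow> 'k::field_char_0) \<Rightarrow> real" where
  "weil_height n a = field_height n a powr (1 / real (field_degree TYPE('k)))"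


section \<open>Semigroups and cones\<close>

definition Sg :: "nat \<Rightarrow> (nat \<Rightarrow> 'k::field_char_0) \<Rightarrow> 'k set" where
  "Sg n a = {(\<Sum>i=1..n. a i * of_nat (x i)) | x :: nat \<Rightarrow> nat. True}"

definition rat_cone :: "nat \<Rightarrow> (nat \<Rightarrow> 'k::field_char_0) \<Rightarrow> 'k set" where
  "rat_cone n a = {(\<Sum>i=1..n. a i * of_rat (x i)) | x :: nat \<Rightarrow> rat. \<forall>i\<in>{1..n}. x i \<ge> 0}"

end

theory Submission
  imports Defs "HOL-Algebra.Algebraic_Closure_Type"
begin

text \<open>
  Let \<open>\<sigma>\<^sub>1, \<dots>, \<sigma>\<^sub>d\<close> be the embeddings of \<open>K\<close>, let \<open>w\<close> be an integral basis,
  and put \<open>D(b) = det (\<sigma>\<^sub>i (b\<^sub>j))\<close> for a \<open>d\<close>-tuple \<open>b\<close> in \<open>K\<close>, so that \<open>|\<Delta>| = |D(w)|\<^sup>2\<close>. The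
  proof compares two estimates of \<open>D(b)\<close> for one suitable \<open>b\<close> whose entries are among the
  \<open>\<alpha>\<^sub>i\<close>.
  
  The lower estimate is \<open>|D(b)| \<ge> 2 |D(w)|\<close> (lemma \<open>large_conj_det\<close>). Choose an integer \<open>x\<close> of
  \<open>K\<close> in the rational cone but not in the semigroup. By Caratheodory's theorem
  (\<open>rational_caratheodory\<close>) it can be written as \<open>\<Sum> r\<^sub>j b\<^sub>j\<close> with
  \<open>r\<^sub>j \<ge> 0\<close>, where the \<open>b\<^sub>j\<close> form a basis of \<open>K\<close> over the rationals. Some \<open>r\<^sub>t\<close> is not an
  integer, for otherwise \<open>x\<close> would lie in the semigroup. Replacing \<open>b\<^sub>t\<close> by the integer
  \<open>\<Sum> frac(r\<^sub>j) b\<^sub>j\<close> multiplies \<open>D(b)\<close> by \<open>frac(r\<^sub>t)\<close>, a number strictly between \<open>0\<close> and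
  \<open>1\<close>. The value of \<open>D\<close> at any tuple of integers is a rational integer multiple of \<open>D(w)\<close>; hence the
  multiple belonging to \<open>b\<close> is larger in absolute value than another nonzero multiple, so it
  is at least \<open>2\<close>.
  
  The upper estimate is \<open>|D(b)| \<le> d! H\<^sub>K(\<alpha>)\<close>: by the Leibniz formula
  (\<open>conj_det_bound\<close>) \<open>|D(b)|\<close> is at most \<open>d!\<close> times the product over \<open>\<sigma>\<close> of
  \<open>max {1, |\<sigma>(\<alpha>\<^sub>1)|, \<dots>, |\<sigma>(\<alpha>\<^sub>n)|}\<close>, and this product is the height
  (\<open>field_height_eq_prod_embeddings\<close>).
  
  Together \<open>H\<^sub>K(\<alpha>)\<^sup>2 \<ge> 4 |\<Delta>| / (d!)\<^sup>2\<close>, which is stronger than the assertion because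
  \<open>d! \<surd>(n - d + 1) (n - d - 1)! \<le> 2 n!\<close> (\<open>factorial_bound\<close>).
  
  The arithmetic behind these estimates is as follows. The primitive element
  theorem shows that there are exactly \<open>d\<close> embeddings, and also that the archimedean places are
  the absolute values \<open>|\<sigma>|\<close>: if \<open>K\<close> is generated by a root \<open>\<theta>\<close> of a polynomial with only real
  roots, an archimedean absolute value forces \<open>\<theta>\<close> to be a limit of rational numbers
  converging to one of them. A real place has local degree \<open>1\<close> because its completion is the
  field of real numbers. At the other places an algebraic integer has absolute value at most
  \<open>1\<close>. Finally, an integral basis is obtained from the finitely many generators \<open>\<alpha>\<^sub>i\<close> by
  Euclid's algorithm.
\<close>

section \<open>Rational polynomials and primitive elements\<close>

text \<open>
  The same rational polynomial is evaluated in a number field, in the complex numbers and in an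
  algebraic closure.
\<close>

definition rpoly :: "rat poly \<Rightarrow> 'a::field_char_0 \<Rightarrow> 'a" where
  "rpoly p x = poly (map_poly of_rat p) x"

lemma map_poly_of_rat_pCons [simp]:
  "map_poly of_rat (pCons a p) = pCons (of_rat a :: 'a::field_char_0) (map_poly of_rat p)"
  by (simp add: map_poly_pCons)

lemma rpoly_0 [simp]: "rpoly 0 x = 0"
  and rpoly_pCons [simp]: "rpoly (pCons a p) x = of_rat a + x * rpoly p x"
  by (simp_all add: rpoly_def)

lemma rpoly_1 [simp]: "rpoly 1 x = 1"
  by (simp add: one_pCons)

lemma rpoly_add [simp]: "rpoly (p + q) x = rpoly p x + rpoly q x"
proof (induction p arbitrary: q)
  case (pCons a p)
  then show ?case by (cases q) (simp_all add: of_rat_add algebra_simps)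
qed simp

lemma rpoly_smult [simp]: "rpoly (Polynomial.smult a p) x = of_rat a * rpoly p x"
  by (induction p) (simp_all add: of_rat_mult algebra_simps)

lemma rpoly_minus [simp]: "rpoly (- p) x = - rpoly p x"
  by (induction p) (simp_all add: of_rat_minus algebra_simps)

lemma rpoly_diff [simp]: "rpoly (p - q) x = rpoly p x - rpoly q x"
  using rpoly_add[of p "- q" x] by simp

lemma rpoly_mult [simp]: "rpoly (p * q) x = rpoly p x * rpoly q x"
  by (induction p) (simp_all add: algebra_simps)

lemma rpoly_sum [simp]: "rpoly (\<Sum>i\<in>A. f i) x = (\<Sum>i\<in>A. rpoly (f i) x)"
  by (induction A rule: infinite_finite_induct) simp_all

lemma rpoly_monom [simp]: "rpoly (Polynomial.monom a n) x = of_rat a * x ^ n"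
  by (simp add: rpoly_def map_poly_monom poly_monom)

lemma rpoly_pcompose [simp]: "rpoly (pcompose p q) x = rpoly p (rpoly q x)"
  by (induction p) (simp_all add: pcompose_pCons)

lemma pderiv_map_poly_of_rat:
  "pderiv (map_poly of_rat p :: 'a::field_char_0 poly) = map_poly of_rat (pderiv p)"
  by (rule poly_eqI) (simp add: coeff_pderiv coeff_map_poly of_rat_mult of_rat_add)

text \<open>
  This determines \<open>p\<close> up to a nonzero rational factor.
\<close>

definition is_minpoly :: "rat poly \<Rightarrow> 'a::field_char_0 \<Rightarrow> bool" where
  "is_minpoly p x \<longleftrightarrow> p \<noteq> 0 \<and> rpoly p x = 0 \<and> (\<forall>q. q \<noteq> 0 \<longrightarrow> rpoly q x = 0 \<longrightarrow> Polynomial.degree p \<le> Polynomial.degree q)"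

lemma minpoly_exists:
  assumes "p \<noteq> 0" "rpoly p x = 0"
  obtains m where "is_minpoly m x"
proof -
  define Q where "Q = (\<lambda>q::rat poly. q \<noteq> 0 \<and> rpoly q x = 0)"
  have "Q (arg_min Polynomial.degree Q) \<and> (\<forall>q. Q q \<longrightarrow> Polynomial.degree (arg_min Polynomial.degree Q) \<le> Polynomial.degree q)"
    using arg_min_nat_lemma[of Q p Polynomial.degree] assms unfolding Q_def by blast
  then show ?thesis using that unfolding is_minpoly_def Q_def by blast
qed

lemma minpoly_dvd:
  assumes "is_minpoly m x" "rpoly q x = 0"
  shows "m dvd q"
proof -
  have "rpoly (q mod m) x = 0"
    using assms rpoly_add[of "q div m * m" "q mod m" x] by (simp add: is_minpoly_def)
  moreover have "q mod m = 0 \<or> Polynomial.degree (q mod m) < Polynomial.degree m"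
    using assms(1) degree_mod_less is_minpoly_def by blast
  ultimately show ?thesis
    using assms(1) unfolding is_minpoly_def by (meson dvd_eq_mod_eq_0 leD)
qed

text \<open>
  If \<open>g = gcd q m\<close> had positive degree, the cofactor \<open>m / g\<close> would be an annihilator of \<open>x\<close> of
  smaller degree than \<open>m\<close>, since \<open>g\<close>, as a divisor of \<open>q\<close>, does not vanish at \<open>x\<close>.
\<close>

lemma minpoly_bezout:
  assumes "is_minpoly m x" "rpoly q x \<noteq> 0"
  obtains u v where "u * q + v * m = 1"
proof -
  define g where "g = gcd q m"
  obtain s where s: "m = g * s" unfolding g_def by (rule dvdE[OF gcd_dvd2])
  obtain t where t: "q = g * t" unfolding g_def by (rule dvdE[OF gcd_dvd1])
  have gx: "rpoly g x \<noteq> 0" using assms(2) t by auto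
  have m: "m \<noteq> 0" "rpoly m x = 0" using assms(1) by (auto simp: is_minpoly_def)
  have "rpoly s x = 0" using m gx s by auto
  moreover have "s \<noteq> 0" "g \<noteq> 0" using m s by auto
  ultimately have "Polynomial.degree m \<le> Polynomial.degree s" using assms(1) by (simp add: is_minpoly_def)
  then have "Polynomial.degree g = 0" using s \<open>s \<noteq> 0\<close> \<open>g \<noteq> 0\<close> by (simp add: degree_mult_eq)
  then have "is_unit g" using \<open>g \<noteq> 0\<close> by (simp add: is_unit_iff_degree)
  then have "coprime q m" unfolding g_def by (simp add: coprime_iff_gcd_eq_1)
  then show ?thesis using that bezout_coefficients_fst_snd[of q m] by simp
qed

text \<open>
  The Bezout identity between \<open>m\<close> and its derivative has rational coefficients, so it excludes
  multiple roots in every extension field at once.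
\<close>

lemma minpoly_separable:
  assumes "is_minpoly m x" "rpoly m (z::'b::field_char_0) = 0"
  shows "rpoly (pderiv m) z \<noteq> 0"
proof -
  have m: "m \<noteq> 0" "rpoly m x = 0" using assms(1) by (auto simp: is_minpoly_def)
  have "Polynomial.degree m \<noteq> 0"
  proof
    assume "Polynomial.degree m = 0"
    then obtain a where "m = [:a:]" by (rule degree_eq_zeroE)
    then show False using m by simp
  qed
  then have "pderiv m \<noteq> 0" "Polynomial.degree (pderiv m) < Polynomial.degree m"
    by (simp_all add: pderiv_eq_0_iff degree_pderiv)
  then have "rpoly (pderiv m) x \<noteq> 0"
    using assms(1) unfolding is_minpoly_def by (meson leD)
  from minpoly_bezout[OF assms(1) this] obtain u v where uv: "u * pderiv m + v * m = 1" .
  show ?thesis using assms(2) arg_cong[OF uv, of "\<lambda>p. rpoly p z"] by auto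
qed

definition is_subfield :: "'a::field_char_0 set \<Rightarrow> bool" where
  "is_subfield R \<longleftrightarrow> 1 \<in> R \<and> (\<forall>x\<in>R. \<forall>y\<in>R. x - y \<in> R \<and> x * y \<in> R \<and> inverse x \<in> R)"

lemma is_subfieldD:
  assumes "is_subfield R"
  shows "1 \<in> R" "0 \<in> R" "x \<in> R \<Longrightarrow> y \<in> R \<Longrightarrow> x - y \<in> R" "x \<in> R \<Longrightarrow> y \<in> R \<Longrightarrow> x * y \<in> R"
    "x \<in> R \<Longrightarrow> inverse x \<in> R" "x \<in> R \<Longrightarrow> - x \<in> R" "x \<in> R \<Longrightarrow> y \<in> R \<Longrightarrow> x + y \<in> R"
    "x \<in> R \<Longrightarrow> y \<in> R \<Longrightarrow> x / y \<in> R"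
proof -
  show *: "1 \<in> R" "x \<in> R \<Longrightarrow> y \<in> R \<Longrightarrow> x - y \<in> R" "x \<in> R \<Longrightarrow> y \<in> R \<Longrightarrow> x * y \<in> R"
    "x \<in> R \<Longrightarrow> inverse x \<in> R" for x y
    using assms unfolding is_subfield_def by auto
  show 0: "0 \<in> R" using *(2)[OF *(1) *(1)] by simp
  show m: "x \<in> R \<Longrightarrow> - x \<in> R" for x using *(2)[OF 0, of x] by simp
  show "x \<in> R \<Longrightarrow> y \<in> R \<Longrightarrow> x + y \<in> R" using *(2)[of x "- y"] m by simp
  show "x \<in> R \<Longrightarrow> y \<in> R \<Longrightarrow> x / y \<in> R" using *(3)[of x "inverse y"] *(4)[of y] by (simp add: divide_inverse)
qed

text \<open>
  Inverses come from the Bezout identity with the minimal polynomial of \<open>x\<close>.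
\<close>

lemma rpoly_range_subfield:
  assumes "p \<noteq> 0" "rpoly p x = 0"
  shows "is_subfield (range (\<lambda>q. rpoly q x))"
proof -
  obtain m where m: "is_minpoly m x" using minpoly_exists[OF assms] .
  have inv: "\<exists>u. inverse (rpoly q x) = rpoly u x" for q
  proof (cases "rpoly q x = 0")
    case True
    then show ?thesis by (intro exI[of _ 0]) simp
  next
    case False
    from minpoly_bezout[OF m this] obtain u v where "u * q + v * m = 1" .
    then have "rpoly (u * q + v * m) x = 1" by simp
    then have "rpoly u x * rpoly q x = 1" using m by (simp add: is_minpoly_def)
    then show ?thesis using False by (intro exI[of _ u]) (simp add: field_simps)
  qed
  show ?thesis unfolding is_subfield_def
  proof (intro conjI ballI)
    show "1 \<in> range (\<lambda>q. rpoly q x)" by (rule range_eqI[of _ _ 1]) simp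
    fix a b assume "a \<in> range (\<lambda>q. rpoly q x)" "b \<in> range (\<lambda>q. rpoly q x)"
    then obtain p q where [simp]: "a = rpoly p x" "b = rpoly q x" by auto
    show "a - b \<in> range (\<lambda>q. rpoly q x)" by (rule range_eqI[of _ _ "p - q"]) simp
    show "a * b \<in> range (\<lambda>q. rpoly q x)" by (rule range_eqI[of _ _ "p * q"]) simp
    show "inverse a \<in> range (\<lambda>q. rpoly q x)" using inv[of p] by auto
  qed
qed

text \<open>
  The minimal polynomial of \<open>y\<close> over the subfield \<open>R\<close>. Polynomials over \<open>R\<close> are represented
  by polynomials over the whole field with coefficients in \<open>R\<close>; one step of polynomial long
  division stays within them.
\<close>

lemma minpoly_over_subfield:
  fixes R :: "'a::field_char_0 set"
  assumes R: "is_subfield R" and G: "G \<noteq> 0" "poly G y = 0" "range (Polynomial.coeff G) \<subseteq> R"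
  obtains h where "h \<noteq> 0" "poly h y = 0" "range (Polynomial.coeff h) \<subseteq> R"
    "\<And>P. poly P y = 0 \<Longrightarrow> range (Polynomial.coeff P) \<subseteq> R \<Longrightarrow> h dvd P"
proof -
  define Q where "Q = (\<lambda>q. q \<noteq> 0 \<and> poly q y = 0 \<and> range (Polynomial.coeff q) \<subseteq> R)"
  define h where "h = arg_min Polynomial.degree Q"
  have "Q h \<and> (\<forall>q. Q q \<longrightarrow> Polynomial.degree h \<le> Polynomial.degree q)"
    using arg_min_nat_lemma[of Q G Polynomial.degree] G unfolding Q_def h_def by blast
  then have h: "h \<noteq> 0" "poly h y = 0" "\<And>i. Polynomial.coeff h i \<in> R"
    and min: "\<And>q. Q q \<Longrightarrow> Polynomial.degree h \<le> Polynomial.degree q" unfolding Q_def by auto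
  have "h dvd P" if "poly P y = 0" "range (Polynomial.coeff P) \<subseteq> R" for P
    using that
  proof (induction "Polynomial.degree P" arbitrary: P rule: less_induct)
    case less
    show ?case
    proof (cases "P = 0")
      case False
      then have le: "Polynomial.degree h \<le> Polynomial.degree P" using min less.prems by (auto simp: Q_def)
      define c where "c = Polynomial.lead_coeff P / Polynomial.lead_coeff h"
      define S where "S = Polynomial.monom c (Polynomial.degree P - Polynomial.degree h) * h"
      have cR: "c \<in> R" unfolding c_def using is_subfieldD(8)[OF R] h less.prems by blast
      have c0: "c \<noteq> 0" using h False by (simp add: c_def)
      have dS: "Polynomial.degree S = Polynomial.degree P" unfolding S_def
        using h c0 le by (simp add: degree_mult_eq degree_monom_eq)
      have lS: "Polynomial.coeff S (Polynomial.degree P) = Polynomial.lead_coeff P"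
        using h le by (simp add: S_def coeff_monom_mult c_def)
      have SR: "range (Polynomial.coeff (P - S)) \<subseteq> R"
        using less.prems(2) h(3) cR
        by (auto simp: S_def coeff_monom_mult intro!: is_subfieldD(2-4)[OF R])
      have Sy: "poly (P - S) y = 0" using less.prems h by (simp add: S_def)
      have hS: "h dvd S" by (simp add: S_def)
      have "h dvd P - S"
      proof (cases "Polynomial.degree (P - S) < Polynomial.degree P")
        case True
        then show ?thesis using less.hyps Sy SR by blast
      next
        case False
        then have "Polynomial.degree (P - S) = Polynomial.degree P"
          using degree_diff_le[of P "Polynomial.degree P" S] dS by simp
        moreover have "Polynomial.coeff (P - S) (Polynomial.degree P) = 0" using lS by simp
        ultimately have "P - S = 0" by (metis leading_coeff_0_iff)
        then show ?thesis by (simp only: dvd_0_right)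
      qed
      then show ?thesis using hS by (metis diff_add_cancel dvd_add)
    qed simp
  qed
  then show ?thesis using that[of h] h by blast
qed

lemma to_ac_of_rat [simp]: "to_ac (of_rat q :: 'a::field_char_0) = of_rat q"
proof (cases q)
  case (Fract a b)
  then show ?thesis by (simp add: of_rat_rat)
qed

lemma poly_map_poly_to_ac: "poly (map_poly to_ac p) (to_ac x) = to_ac (poly p x)"
  by (induction p) (simp_all add: map_poly_pCons)

lemma map_poly_to_ac_mult: "map_poly to_ac (p * q) = map_poly to_ac p * map_poly to_ac q"
  by (rule poly_eqI) (simp add: coeff_map_poly coeff_mult to_ac_sum)

lemma map_poly_to_ac_add: "map_poly to_ac (p + q) = map_poly to_ac p + map_poly to_ac q"
  and map_poly_to_ac_uminus: "map_poly to_ac (- p) = - map_poly to_ac p"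
  and map_poly_to_ac_smult:
    "map_poly to_ac (Polynomial.smult a p) = Polynomial.smult (to_ac a) (map_poly to_ac p)"
  by (rule poly_eqI, simp add: coeff_map_poly)+

lemma poly_map_poly_to_ac_of_rat:
  "poly (map_poly to_ac (map_poly of_rat p :: 'a::field_char_0 poly)) z = rpoly p z"
  by (induction p) (simp_all add: map_poly_pCons)

text \<open>
  Let \<open>f\<close> and \<open>g\<close> be rational polynomials with roots \<open>\<theta>\<close> and \<open>y\<close>, where \<open>g\<close> is separable. For all but
  finitely many \<open>c\<close>, the element \<open>\<gamma> = \<theta> + c y\<close> has the property that \<open>y\<close> is the only common root
  of \<open>g\<close> and \<open>f(\<gamma> - c X)\<close> in an algebraic closure. The minimal polynomial of \<open>y\<close> over the field
  generated by \<open>\<gamma>\<close> divides both of these polynomials, so it is linear, and \<open>y\<close> lies in that field.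
\<close>

lemma primitive_element_step:
  fixes \<theta> y :: "'a::field_char_0"
  assumes alg: "\<And>x::'a. \<exists>p. p \<noteq> 0 \<and> rpoly p x = 0"
  obtains \<gamma> where "\<theta> \<in> range (\<lambda>p. rpoly p \<gamma>)" "y \<in> range (\<lambda>p. rpoly p \<gamma>)"
proof -
  obtain f where f: "f \<noteq> 0" "rpoly f \<theta> = 0" using alg by blast
  obtain g where g: "is_minpoly g y" using alg minpoly_exists by metis
  have g0: "g \<noteq> 0" "rpoly g y = 0" using g by (auto simp: is_minpoly_def)
  define A where "A = {z::'a alg_closure. rpoly f z = 0}"
  define B where "B = {z::'a alg_closure. rpoly g z = 0}"
  have "finite A" "finite B" unfolding A_def B_def rpoly_def
    using f(1) g0(1) by (auto intro!: poly_roots_finite simp: map_poly_eq_0_iff)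
  then have "finite ((\<lambda>(a, b). (a - to_ac \<theta>) / (to_ac y - b)) ` (A \<times> B))" (is "finite ?E") by blast
  moreover have "infinite (range (of_nat :: nat \<Rightarrow> 'a alg_closure))"
    by (rule range_inj_infinite) (simp add: inj_on_def)
  ultimately have "\<not> range (of_nat :: nat \<Rightarrow> 'a alg_closure) \<subseteq> ?E" using finite_subset by blast
  \<comment> \<open>For these slopes \<open>n\<close> no root \<open>a\<close> of \<open>f\<close> and no root \<open>b \<noteq> y\<close> of \<open>g\<close> satisfy \<open>a + n b = \<theta> + n y\<close>.\<close>
  then obtain n where n: "of_nat n \<notin> ?E" by blast
  define c :: 'a where "c = of_nat n"
  define \<gamma> where "\<gamma> = \<theta> + c * y"
  define R where "R = range (\<lambda>p. rpoly p \<gamma>)"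
  have R: "is_subfield R" unfolding R_def using alg[of \<gamma>] rpoly_range_subfield by blast
  have ratR: "of_rat q \<in> R" for q unfolding R_def by (rule range_eqI[of _ _ "[:q:]"]) simp
  have \<gamma>R: "\<gamma> \<in> R" unfolding R_def by (rule range_eqI[of _ _ "[:0, 1:]"]) simp
  have cR: "c \<in> R" using ratR[of "of_nat n"] by (simp add: c_def)
  define G :: "'a poly" where "G = map_poly of_rat g"
  define F :: "'a poly" where "F = pcompose (map_poly of_rat f) [:\<gamma>, - c:]"
  have GR: "range (Polynomial.coeff G) \<subseteq> R" using ratR by (auto simp: G_def coeff_map_poly)
  have linR: "range (Polynomial.coeff ([:\<gamma>, - c:] * P)) \<subseteq> R" if P: "range (Polynomial.coeff P) \<subseteq> R" for P
  proof -
    have "Polynomial.coeff P i \<in> R" for i using P by blast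
    then show ?thesis using \<gamma>R cR is_subfieldD(2)[OF R]
      by (auto simp: coeff_pCons split: nat.split intro!: is_subfieldD(3,4)[OF R])
  qed
  have FR: "range (Polynomial.coeff F) \<subseteq> R" unfolding F_def
  proof (induction f)
    case 0
    then show ?case using is_subfieldD[OF R] by auto
  next
    case (pCons a p)
    have "Polynomial.coeff (pcompose (map_poly of_rat (pCons a p)) [:\<gamma>, - c:]) i \<in> R" for i
    proof -
      have "Polynomial.coeff ([:\<gamma>, - c:] * pcompose (map_poly of_rat p) [:\<gamma>, - c:]) i \<in> R" for i
        using linR[OF pCons.IH] by blast
      then show ?thesis using ratR[of a] is_subfieldD(2)[OF R]
      by (auto simp: pcompose_pCons coeff_pCons[of a] coeff_pCons split: nat.split
          simp del: mult_pCons_left intro!: is_subfieldD(7)[OF R])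
    qed
    then show ?case by blast
  qed
  have Gy: "poly G y = 0" "G \<noteq> 0" using g0 by (auto simp: G_def rpoly_def map_poly_eq_0_iff)
  have Fy: "poly F y = 0" using f(2) by (simp add: F_def poly_pcompose \<gamma>_def rpoly_def algebra_simps)
  obtain h where h: "h \<noteq> 0" "poly h y = 0" "range (Polynomial.coeff h) \<subseteq> R"
    and hdvd: "\<And>P. poly P y = 0 \<Longrightarrow> range (Polynomial.coeff P) \<subseteq> R \<Longrightarrow> h dvd P"
    using minpoly_over_subfield[OF R Gy(2,1) GR] by metis
  have hG: "h dvd G" and hF: "h dvd F" using hdvd Gy Fy GR FR by blast+
  have common: "z = to_ac y" if z: "poly (map_poly to_ac h) z = 0" for z
  proof (rule ccontr)
    assume ne: "z \<noteq> to_ac y"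
    obtain G' F' where "G = h * G'" "F = h * F'" using hG hF by (auto elim!: dvdE)
    then have "poly (map_poly to_ac G) z = 0" "poly (map_poly to_ac F) z = 0"
      using z by (simp_all add: map_poly_to_ac_mult)
    moreover have "poly (map_poly to_ac F) z = rpoly f (to_ac \<gamma> - to_ac c * z)"
      unfolding F_def
      by (induction f) (simp_all add: pcompose_pCons map_poly_pCons map_poly_to_ac_add
          map_poly_to_ac_smult map_poly_to_ac_uminus algebra_simps)
    ultimately have "z \<in> B" "to_ac \<gamma> - to_ac c * z \<in> A"
      by (simp_all add: A_def B_def G_def poly_map_poly_to_ac_of_rat)
    then have "((to_ac \<gamma> - to_ac c * z) - to_ac \<theta>) / (to_ac y - z) \<in> ?E" by force
    moreover have "((to_ac \<gamma> - to_ac c * z) - to_ac \<theta>) / (to_ac y - z) = of_nat n"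
      using ne by (simp add: \<gamma>_def c_def field_simps)
    ultimately show False using n by simp
  qed
  have "Polynomial.degree h = 1"
  proof -
    obtain s where s: "h = [:- y, 1:] * s" using h(2) by (auto simp: poly_eq_0_iff_dvd elim: dvdE)
    have "s \<noteq> 0" using s h by auto
    have "Polynomial.degree s = 0"
    proof (rule ccontr)
      assume "Polynomial.degree s \<noteq> 0"
      then have "Polynomial.degree (map_poly to_ac s) > 0" by (simp add: degree_map_poly)
      then obtain z where z: "poly (map_poly to_ac s) z = 0" using alg_closed_imp_poly_has_root by blast
      then have "poly (map_poly to_ac h) z = 0" unfolding s map_poly_to_ac_mult by simp
      then have "z = to_ac y" by (rule common)
      then have "poly s y = 0" using z by (simp add: poly_map_poly_to_ac)
      then have "poly (pderiv h) y = 0" unfolding s by (simp add: pderiv_diff pderiv_smult pderiv_pCons)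
      moreover obtain G' where "G = h * G'" using hG by (auto elim!: dvdE)
      ultimately have "poly (pderiv G) y = 0" using h(2) by (simp add: pderiv_mult)
      then have "rpoly (pderiv g) y = 0" by (simp add: G_def pderiv_map_poly_of_rat rpoly_def)
      then show False using minpoly_separable[OF g g0(2)] by simp
    qed
    then show ?thesis unfolding s using \<open>s \<noteq> 0\<close> by (subst degree_mult_eq) auto
  qed
  define h0 h1 where "h0 = Polynomial.coeff h 0" and "h1 = Polynomial.coeff h 1"
  have h1: "h1 \<noteq> 0"
    using \<open>Polynomial.degree h = 1\<close> leading_coeff_neq_0[OF h(1)] by (simp add: h1_def)
  have hh: "h = [:h0, h1:]"
    using \<open>Polynomial.degree h = 1\<close>
    by (auto simp: poly_eq_iff coeff_pCons h0_def h1_def coeff_eq_0 split: nat.split)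
  have "h0 \<in> R" "h1 \<in> R" using h(3) unfolding h0_def h1_def by blast+
  moreover have "y = - h0 / h1" using h(2) hh h1 by (simp add: field_simps eq_neg_iff_add_eq_0)
  ultimately have yR: "y \<in> R" using is_subfieldD(6,8)[OF R] by blast
  have "\<theta> = \<gamma> - c * y" by (simp add: \<gamma>_def)
  then have "\<theta> \<in> R" using yR \<gamma>R cR is_subfieldD(3,4)[OF R] by blast
  then show ?thesis using that yR unfolding R_def by blast
qed

section \<open>Number fields\<close>

interpretation rat_vs: vector_space "\<lambda>(q::rat) (x::'k::field_char_0). of_rat q * x"
  by standard (simp_all add: of_rat_add of_rat_mult algebra_simps)

text \<open>
  One more power of \<open>x\<close> than there are elements in a spanning set: either two powers coincide or
  the powers are linearly dependent.
\<close>

lemma number_field_algebraic: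
  assumes "number_field TYPE('k::field_char_0)"
  shows "\<exists>p. p \<noteq> 0 \<and> rpoly p (x::'k) = 0"
proof -
  obtain B :: "'k set" where B: "finite B" "rat_vs.span B = UNIV"
    using assms unfolding number_field_def by blast
  define N where "N = card B"
  show ?thesis
  proof (cases "inj_on (\<lambda>i. x ^ i) {..N}")
    case False
    then obtain i j where "i \<noteq> j" "x ^ i = x ^ j" unfolding inj_on_def by blast
    then show ?thesis
      by (intro exI[of _ "Polynomial.monom 1 i - Polynomial.monom 1 j"])
        (auto simp: poly_eq_iff intro!: exI[of _ i])
  next
    case True
    define S where "S = (\<lambda>i. x ^ i) ` {..N}"
    have "card S = Suc N" "finite S" using True by (simp_all add: S_def card_image)
    then have "rat_vs.dependent S"
      using rat_vs.independent_span_bound[OF B(1), of S] B(2) by (auto simp: N_def)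
    then obtain u where u: "\<exists>v\<in>S. u v \<noteq> 0" "(\<Sum>v\<in>S. of_rat (u v) * v) = 0"
      using rat_vs.dependent_finite[OF \<open>finite S\<close>] by blast
    define p where "p = (\<Sum>i\<le>N. Polynomial.monom (u (x ^ i)) i)"
    have "rpoly p x = (\<Sum>v\<in>S. of_rat (u v) * v)"
      unfolding p_def S_def using True by (simp add: sum.reindex)
    moreover obtain i where i: "i \<le> N" "u (x ^ i) \<noteq> 0" using u(1) by (auto simp: S_def)
    have "Polynomial.coeff p i = u (x ^ i)" using i by (simp add: p_def coeff_sum)
    then have "p \<noteq> 0" using i by auto
    ultimately show ?thesis using u by auto
  qed
qed

theorem primitive_element:
  assumes "number_field TYPE('k::field_char_0)"
  obtains \<theta> :: "'k::field_char_0" where "range (\<lambda>p. rpoly p \<theta>) = UNIV"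
proof -
  have alg: "\<exists>p. p \<noteq> 0 \<and> rpoly p x = 0" for x :: 'k using number_field_algebraic[OF assms] .
  obtain B :: "'k set" where B: "finite B" "rat_vs.span B = UNIV"
    using assms unfolding number_field_def by blast
  have "\<exists>\<theta>. B \<subseteq> range (\<lambda>p. rpoly p \<theta>)" using B(1)
  proof (induction B)
    case (insert y B)
    then obtain \<theta> where \<theta>: "B \<subseteq> range (\<lambda>p. rpoly p \<theta>)" by blast
    obtain \<gamma> q where \<gamma>: "\<theta> = rpoly q \<gamma>" "y \<in> range (\<lambda>p. rpoly p \<gamma>)"
      using primitive_element_step[OF alg, of \<theta> y] by (metis image_iff)
    have "range (\<lambda>p. rpoly p \<theta>) \<subseteq> range (\<lambda>p. rpoly p \<gamma>)"
      by (auto simp: \<gamma>(1) simp flip: rpoly_pcompose)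
    then show ?case using \<theta> \<gamma>(2) by blast
  qed simp
  then obtain \<theta> where \<theta>: "B \<subseteq> range (\<lambda>p. rpoly p \<theta>)" by blast
  have "rat_vs.subspace (range (\<lambda>p. rpoly p \<theta>))" unfolding rat_vs.subspace_def
  proof (intro conjI ballI allI)
    show "0 \<in> range (\<lambda>p. rpoly p \<theta>)" by (rule range_eqI[of _ _ 0]) simp
    fix x y c assume "x \<in> range (\<lambda>p. rpoly p \<theta>)"
    then obtain p where p: "x = rpoly p \<theta>" by blast
    show "of_rat c * x \<in> range (\<lambda>p. rpoly p \<theta>)"
      by (rule range_eqI[of _ _ "Polynomial.smult c p"]) (simp add: p)
    assume "y \<in> range (\<lambda>p. rpoly p \<theta>)"
    then obtain q where q: "y = rpoly q \<theta>" by blast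
    show "x + y \<in> range (\<lambda>p. rpoly p \<theta>)" by (rule range_eqI[of _ _ "p + q"]) (simp add: p q)
  qed
  then have "rat_vs.span B \<subseteq> range (\<lambda>p. rpoly p \<theta>)" using \<theta> by (rule rat_vs.span_minimal[rotated])
  then show ?thesis using that B(2) by blast
qed

section \<open>Embeddings\<close>

lemma embedding_simps:
  fixes \<sigma> :: "'k::field_char_0 \<Rightarrow> 'l::field_char_0"
  assumes "\<sigma> \<in> field_embeddings"
  shows embedding_1: "\<sigma> 1 = 1" and embedding_add: "\<sigma> (x + y) = \<sigma> x + \<sigma> y"
    and embedding_mult: "\<sigma> (x * y) = \<sigma> x * \<sigma> y" and embedding_0: "\<sigma> 0 = 0"
    and embedding_minus: "\<sigma> (- x) = - \<sigma> x" and embedding_diff: "\<sigma> (x - y) = \<sigma> x - \<sigma> y"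
    and embedding_eq_0: "\<sigma> x = 0 \<longleftrightarrow> x = 0"
    and embedding_of_nat: "\<sigma> (of_nat n) = of_nat n"
    and embedding_of_int: "\<sigma> (of_int k) = of_int k"
    and embedding_of_rat: "\<sigma> (of_rat q) = of_rat q"
    and embedding_rpoly: "\<sigma> (rpoly p x) = rpoly p (\<sigma> x)"
proof -
  show one: "\<sigma> 1 = 1" and add: "\<sigma> (x + y) = \<sigma> x + \<sigma> y" and mult: "\<sigma> (x * y) = \<sigma> x * \<sigma> y" for x y
    using assms by (auto simp: field_embeddings_def)
  show zero: "\<sigma> 0 = 0" using add[of 0 0] by simp
  show minus: "\<sigma> (- x) = - \<sigma> x" for x using add[of x "- x"] zero by (simp add: eq_neg_iff_add_eq_0 add.commute)
  show "\<sigma> (x - y) = \<sigma> x - \<sigma> y" using add[of x "- y"] minus by simp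
  show inj: "\<sigma> x = 0 \<longleftrightarrow> x = 0" for x
  proof
    assume "\<sigma> x = 0"
    then show "x = 0" using mult[of x "inverse x"] one by (cases "x = 0") auto
  qed (simp add: zero)
  show nat: "\<sigma> (of_nat n) = of_nat n" for n by (induction n) (simp_all add: zero one add)
  show int: "\<sigma> (of_int k) = of_int k" for k by (cases k rule: int_cases2) (simp_all add: nat minus)
  show rat: "\<sigma> (of_rat q) = of_rat q" for q
  proof (cases q)
    case (Fract a b)
    have "\<sigma> (of_int a / of_int b) * \<sigma> (of_int b) = \<sigma> (of_int a)"
      using Fract by (simp flip: mult)
    then show ?thesis using Fract by (simp add: of_rat_rat int field_simps)
  qed
  show "\<sigma> (rpoly p x) = rpoly p (\<sigma> x)" by (induction p) (simp_all add: zero add mult rat)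
qed

lemma embedding_sum:
  fixes \<sigma> :: "'k::field_char_0 \<Rightarrow> 'l::field_char_0"
  assumes "\<sigma> \<in> field_embeddings"
  shows "\<sigma> (\<Sum>i\<in>A. f i) = (\<Sum>i\<in>A. \<sigma> (f i))"
  by (induction A rule: infinite_finite_induct) (simp_all add: embedding_simps[OF assms])

lemma embedding_eqI:
  fixes \<sigma> \<tau> :: "'k::field_char_0 \<Rightarrow> 'l::field_char_0"
  assumes "range (\<lambda>p. rpoly p \<theta>) = UNIV" "\<sigma> \<in> field_embeddings" "\<tau> \<in> field_embeddings" "\<sigma> \<theta> = \<tau> \<theta>"
  shows "\<sigma> = \<tau>"
proof
  fix x
  obtain p where "x = rpoly p \<theta>" using assms(1) by (metis UNIV_I image_iff)
  then show "\<sigma> x = \<tau> x" using assms by (simp add: embedding_rpoly)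
qed

text \<open>
  Writing an element as \<open>p(\<theta>)\<close> leaves \<open>p\<close> undetermined up to multiples of \<open>m\<close>, all of which
  vanish at \<open>z\<close>; so \<open>p(\<theta>) \<mapsto> p(z)\<close> is well defined.
\<close>

lemma embedding_of_root:
  fixes z :: "'l::field_char_0"
  assumes \<theta>: "range (\<lambda>p. rpoly p \<theta>) = (UNIV :: 'k::field_char_0 set)"
    and m: "is_minpoly m \<theta>" and z: "rpoly m z = 0"
  obtains \<sigma> :: "'k::field_char_0 \<Rightarrow> 'l::field_char_0" where "\<sigma> \<in> field_embeddings" "\<sigma> \<theta> = z"
proof -
  define \<sigma> where "\<sigma> = (\<lambda>x. rpoly (SOME p. rpoly p \<theta> = x) z)"
  have \<sigma>: "\<sigma> (rpoly p \<theta>) = rpoly p z" for p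
  proof -
    define q where "q = (SOME q. rpoly q \<theta> = rpoly p \<theta>)"
    have "rpoly q \<theta> = rpoly p \<theta>" unfolding q_def by (rule someI) (rule refl)
    then have "rpoly (q - p) \<theta> = 0" by simp
    then have "m dvd q - p" by (rule minpoly_dvd[OF m])
    then obtain r where "q - p = m * r" by (auto elim: dvdE)
    then have "rpoly (q - p) z = 0" using z by simp
    then show ?thesis by (simp add: \<sigma>_def q_def)
  qed
  have "\<sigma> \<in> field_embeddings" unfolding field_embeddings_def
  proof (intro CollectI conjI allI)
    show "\<sigma> 1 = 1" using \<sigma>[of 1] by simp
    fix x y
    obtain p q where "x = rpoly p \<theta>" "y = rpoly q \<theta>" using \<theta> by (metis UNIV_I image_iff)
    then show "\<sigma> (x + y) = \<sigma> x + \<sigma> y" "\<sigma> (x * y) = \<sigma> x * \<sigma> y"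
      using \<sigma>[of "p + q"] \<sigma>[of "p * q"] by (simp_all add: \<sigma>)
  qed
  moreover have "\<sigma> \<theta> = z" using \<sigma>[of "[:0, 1:]"] by simp
  ultimately show ?thesis using that by blast
qed

lemma rpoly_altdef: "rpoly p x = (\<Sum>i\<le>Polynomial.degree p. of_rat (Polynomial.coeff p i) * x ^ i)"
  by (simp add: rpoly_def poly_altdef degree_map_poly coeff_map_poly)

lemma field_degree_minpoly:
  assumes \<theta>: "range (\<lambda>p. rpoly p \<theta>) = (UNIV :: 'k::field_char_0 set)"
    and m: "is_minpoly m \<theta>"
  shows "field_degree TYPE('k) = Polynomial.degree m"
proof -
  define d where "d = Polynomial.degree m"
  have m0: "m \<noteq> 0" "rpoly m \<theta> = 0" using m by (auto simp: is_minpoly_def)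
  have small: "p = 0" if "rpoly p \<theta> = 0" "\<And>i. i \<ge> d \<Longrightarrow> Polynomial.coeff p i = 0" for p
  proof (rule ccontr)
    assume "p \<noteq> 0"
    then have "d \<le> Polynomial.degree p" using m that(1) by (simp add: is_minpoly_def d_def)
    then have "Polynomial.lead_coeff p = 0" by (rule that(2))
    then show False using \<open>p \<noteq> 0\<close> by simp
  qed
  have inj: "inj_on (\<lambda>i. \<theta> ^ i) {..<d}"
  proof
    fix i j assume ij: "i \<in> {..<d}" "j \<in> {..<d}" "\<theta> ^ i = \<theta> ^ j"
    then have "Polynomial.monom 1 i - Polynomial.monom 1 j = (0 :: rat poly)"
      by (intro small) auto
    then show "i = j" by (simp add: monom_eq_iff')
  qed
  define S where "S = (\<lambda>i. \<theta> ^ i) ` {..<d}"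
  have "rat_vs.independent S"
  proof (rule rat_vs.independent_if_scalars_zero)
    show "finite S" by (simp add: S_def)
    fix u :: "'k \<Rightarrow> rat" and x assume *: "(\<Sum>x\<in>S. of_rat (u x) * x) = 0" "x \<in> S"
    define p where "p = (\<Sum>i<d. Polynomial.monom (u (\<theta> ^ i)) i)"
    have cp: "Polynomial.coeff p i = (if i < d then u (\<theta> ^ i) else 0)" for i
      by (simp add: p_def coeff_sum)
    have "rpoly p \<theta> = 0" using * inj by (simp add: p_def S_def sum.reindex)
    then have "p = 0" by (rule small) (simp add: cp)
    moreover obtain i where "i < d" "x = \<theta> ^ i" using *(2) by (auto simp: S_def)
    ultimately show "u x = 0" using cp[of i] by simp
  qed
  moreover have "UNIV \<subseteq> rat_vs.span S"
  proof
    fix x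
    obtain p where p: "x = rpoly p \<theta>" using \<theta> by (metis UNIV_I image_iff)
    define r where "r = p mod m"
    have "x = rpoly r \<theta>" using rpoly_add[of "p div m * m" r \<theta>] m0 by (simp add: p r_def)
    also have "\<dots> = (\<Sum>i\<le>Polynomial.degree r. of_rat (Polynomial.coeff r i) * \<theta> ^ i)" by (rule rpoly_altdef)
    also have "\<dots> \<in> rat_vs.span S"
    proof (rule rat_vs.span_sum)
      fix i assume i: "i \<in> {..Polynomial.degree r}"
      show "of_rat (Polynomial.coeff r i) * \<theta> ^ i \<in> rat_vs.span S"
      proof (cases "Polynomial.coeff r i = 0")
        case True
        then show ?thesis by (simp add: rat_vs.span_zero)
      next
        case False
        then have "r \<noteq> 0" by auto
        then have "Polynomial.degree r < d" using degree_mod_less[OF m0(1), of p] by (simp add: r_def d_def)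
        then have "\<theta> ^ i \<in> S" using i by (auto simp: S_def)
        then show ?thesis by (intro rat_vs.span_scale rat_vs.span_base)
      qed
    qed
    finally show "x \<in> rat_vs.span S" .
  qed
  moreover have "card S = d" using inj by (simp add: S_def card_image)
  ultimately show ?thesis unfolding field_degree_def d_def[symmetric]
    by (intro rat_vs.dim_unique) auto
qed

lemma minpoly_complex_decompose:
  assumes "is_minpoly m x"
  defines "Z \<equiv> {z::complex. rpoly m z = 0}"
  shows "finite Z" "card Z = Polynomial.degree m"
    "map_poly of_rat m = Polynomial.smult (of_rat (Polynomial.lead_coeff m)) (\<Prod>z\<in>Z. [:- z, 1:])"
proof -
  define p :: "complex poly" where "p = map_poly of_rat m"
  have m0: "m \<noteq> 0" using assms by (auto simp: is_minpoly_def)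
  have d: "Polynomial.degree p = Polynomial.degree m" by (simp add: p_def degree_map_poly)
  have lc: "Polynomial.lead_coeff p = of_rat (Polynomial.lead_coeff m)"
    by (simp add: d) (simp add: p_def coeff_map_poly)
  have Z: "Z = {z. poly p z = 0}" by (simp add: Z_def rpoly_def p_def)
  have "rsquarefree p" unfolding rsquarefree_roots
    using minpoly_separable[OF assms(1)] by (auto simp: p_def pderiv_map_poly_of_rat simp flip: rpoly_def)
  from complex_poly_decompose_rsquarefree[OF this]
  have p: "p = Polynomial.smult (of_rat (Polynomial.lead_coeff m)) (\<Prod>z\<in>Z. [:- z, 1:])"
    by (simp add: lc Z)
  then show "map_poly of_rat m = Polynomial.smult (of_rat (Polynomial.lead_coeff m)) (\<Prod>z\<in>Z. [:- z, 1:])"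
    by (simp add: p_def)
  show "finite Z" unfolding Z p_def using m0 by (intro poly_roots_finite) (simp add: map_poly_eq_0_iff)
  have "Polynomial.degree p = card Z"
    by (subst p) (simp add: m0 degree_prod_sum_eq)
  then show "card Z = Polynomial.degree m" using d by simp
qed

lemma embeddings_bij_roots:
  assumes \<theta>: "range (\<lambda>p. rpoly p \<theta>) = (UNIV :: 'k::field_char_0 set)"
    and m: "is_minpoly m \<theta>"
  shows "bij_betw (\<lambda>\<sigma>. \<sigma> \<theta>) (field_embeddings :: ('k \<Rightarrow> complex) set) {z. rpoly m z = 0}"
  unfolding bij_betw_def
proof
  show "inj_on (\<lambda>\<sigma>. \<sigma> \<theta>) (field_embeddings :: ('k \<Rightarrow> complex) set)"
    by (rule inj_onI) (rule embedding_eqI[OF \<theta>])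
  have "rpoly m (\<sigma> \<theta>) = 0" if "\<sigma> \<in> field_embeddings" for \<sigma> :: "'k \<Rightarrow> complex"
    using m embedding_rpoly[OF that, of m \<theta>] embedding_0[OF that] by (simp add: is_minpoly_def)
  moreover have "z \<in> (\<lambda>\<sigma>. \<sigma> \<theta>) ` (field_embeddings :: ('k \<Rightarrow> complex) set)" if "rpoly m z = 0" for z
    by (rule embedding_of_root[OF \<theta> m that]) blast
  ultimately show "(\<lambda>\<sigma>. \<sigma> \<theta>) ` (field_embeddings :: ('k \<Rightarrow> complex) set) = {z. rpoly m z = 0}"
    by blast
qed

text \<open>
  An embedding is determined by the image of a primitive element, which can be any complex root
  of its minimal polynomial; that polynomial is separable of degree \<open>d\<close>.
\<close>

theorem card_complex_embeddings:
  assumes "number_field TYPE('k::field_char_0)"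
  shows "finite (field_embeddings :: ('k \<Rightarrow> complex) set)"
    "card (field_embeddings :: ('k \<Rightarrow> complex) set) = field_degree TYPE('k)"
proof -
  obtain \<theta> :: 'k where \<theta>: "range (\<lambda>p. rpoly p \<theta>) = UNIV" using primitive_element[OF assms] .
  obtain m where m: "is_minpoly m \<theta>" using number_field_algebraic[OF assms] minpoly_exists by metis
  note bij = embeddings_bij_roots[OF \<theta> m] and Z = minpoly_complex_decompose[OF m]
  show "finite (field_embeddings :: ('k \<Rightarrow> complex) set)" using bij_betw_finite[OF bij] Z(1) by simp
  show "card (field_embeddings :: ('k \<Rightarrow> complex) set) = field_degree TYPE('k)"
    using bij_betw_same_card[OF bij] Z(2) field_degree_minpoly[OF \<theta> m] by simp
qed

section \<open>Places of a number field\<close>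

lemma absolute_valueD:
  assumes "absolute_value v"
  shows absolute_value_nonneg: "v x \<ge> 0" and absolute_value_eq_0: "v x = 0 \<longleftrightarrow> x = 0"
    and absolute_value_mult: "v (x * y) = v x * v y" and absolute_value_add: "v (x + y) \<le> v x + v y"
    and absolute_value_1: "v 1 = 1" and absolute_value_minus: "v (- x) = v x"
    and absolute_value_diff: "\<bar>v x - v y\<bar> \<le> v (x - y)"
    and absolute_value_power: "v (x ^ n) = v x ^ n"
    and absolute_value_prod: "v (\<Prod>i\<in>A. f i) = (\<Prod>i\<in>A. v (f i))"
    and absolute_value_sum: "v (\<Sum>i\<in>A. f i) \<le> (\<Sum>i\<in>A. v (f i))"
proof -
  show nonneg: "v x \<ge> 0" and zero: "v x = 0 \<longleftrightarrow> x = 0" and mult: "v (x * y) = v x * v y"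
    and add: "v (x + y) \<le> v x + v y" for x y
    using assms unfolding absolute_value_def by blast+
  have v0: "v 0 = 0" by (simp add: zero)
  show one: "v 1 = 1" using mult[of 1 1] zero[of 1] by simp
  have "v (- 1) * v (- 1) = 1" using mult[of "- 1" "- 1"] one by simp
  then have "v (- 1) = 1" using nonneg[of "- 1"] by (simp add: square_eq_1_iff)
  then show minus: "v (- x) = v x" for x using mult[of "- 1" x] by simp
  show "\<bar>v x - v y\<bar> \<le> v (x - y)"
    using add[of "x - y" y] add[of "y - x" x] minus[of "x - y"] by simp
  show "v (x ^ n) = v x ^ n" by (induction n) (simp_all add: one mult)
  show "v (\<Prod>i\<in>A. f i) = (\<Prod>i\<in>A. v (f i))"
    by (induction A rule: infinite_finite_induct) (simp_all add: one mult)
  show "v (\<Sum>i\<in>A. f i) \<le> (\<Sum>i\<in>A. v (f i))"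
  proof (induction A rule: infinite_finite_induct)
    case (insert i A)
    then show ?case using add[of "f i" "sum f A"] by simp
  qed (simp_all add: v0)
qed

text \<open>
  The ring generated by an algebraic integer is a finitely generated abelian group.
\<close>

lemma algebraic_int_power_span:
  fixes x :: "'a::field_char_0"
  assumes "algebraic_int x"
  obtains m where "\<And>N. \<exists>c::nat \<Rightarrow> int. x ^ N = (\<Sum>i<m. of_int (c i) * x ^ i)"
proof -
  obtain p where p: "poly (map_poly of_int p) x = 0" "Polynomial.lead_coeff p = 1"
    using assms algebraic_int_altdef_ipoly by blast
  define m where "m = Polynomial.degree p"
  have "(\<Sum>i\<le>m. of_int (Polynomial.coeff p i) * x ^ i) = 0"
    using p(1) by (simp add: poly_altdef degree_map_poly coeff_map_poly m_def)
  then have top: "x ^ m = (\<Sum>i<m. of_int (- Polynomial.coeff p i) * x ^ i)"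
    using p(2) by (simp add: lessThan_Suc_atMost[symmetric] m_def sum_negf eq_neg_iff_add_eq_0 add.commute)
  have "\<exists>c::nat \<Rightarrow> int. x ^ N = (\<Sum>i<m. of_int (c i) * x ^ i)" for N
  proof (induction N)
    case 0
    show ?case
    proof (cases m)
      case 0
      then show ?thesis using top by simp
    next
      case (Suc k)
      have "x ^ 0 = (\<Sum>i<m. of_int (if i = 0 then 1 else 0) * x ^ i)"
        unfolding Suc sum.lessThan_Suc_shift by simp
      then show ?thesis by (rule exI[of _ "\<lambda>i. if i = 0 then 1 else 0"])
    qed
  next
    case (Suc N)
    then obtain c :: "nat \<Rightarrow> int" where c: "x ^ N = (\<Sum>i<m. of_int (c i) * x ^ i)" by blast
    show ?case
    proof (cases m)
      case 0
      then show ?thesis using c by simp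
    next
      case (Suc k)
      define c' where "c' i = (if i = 0 then 0 else c (i - 1)) - c k * Polynomial.coeff p i" for i
      have "x ^ Suc N = (\<Sum>i<k. of_int (c i) * x ^ Suc i) + of_int (c k) * x ^ m"
        unfolding power_Suc c Suc by (simp add: sum_distrib_left algebra_simps)
      also have "(\<Sum>i<k. of_int (c i) * x ^ Suc i) = (\<Sum>i<m. of_int (if i = 0 then 0 else c (i - 1)) * x ^ i)"
        unfolding Suc sum.lessThan_Suc_shift by simp
      also have "\<dots> + of_int (c k) * x ^ m = (\<Sum>i<m. of_int (c' i) * x ^ i)"
        unfolding top c'_def by (simp add: sum_distrib_left sum.distrib[symmetric] algebra_simps)
      finally show ?thesis by blast
    qed
  qed
  then show ?thesis using that by blast
qed

text \<open>
  All powers of \<open>x\<close> are integral combinations of finitely many of them, so the powers of \<open>v x\<close>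
  stay bounded.
\<close>

lemma absolute_value_algebraic_int_le_1:
  fixes v :: "'k::field_char_0 \<Rightarrow> real"
  assumes v: "absolute_value v" and int: "\<And>k::int. v (of_int k) \<le> 1" and x: "algebraic_int x"
  shows "v x \<le> 1"
proof (rule ccontr)
  assume "\<not> v x \<le> 1"
  then have gt: "v x > 1" by simp
  obtain m where m: "\<And>N. \<exists>c::nat \<Rightarrow> int. x ^ N = (\<Sum>i<m. of_int (c i) * x ^ i)"
    using algebraic_int_power_span[OF x] by blast
  have "v x ^ N \<le> (\<Sum>i<m. v x ^ i)" for N
  proof -
    obtain c :: "nat \<Rightarrow> int" where c: "x ^ N = (\<Sum>i<m. of_int (c i) * x ^ i)" using m by blast
    have "v x ^ N = v (\<Sum>i<m. of_int (c i) * x ^ i)"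
      using absolute_value_power[OF v, of x N] c by simp
    also have "\<dots> \<le> (\<Sum>i<m. v (of_int (c i) * x ^ i))" by (rule absolute_value_sum[OF v])
    also have "\<dots> \<le> (\<Sum>i<m. v x ^ i)"
    proof (rule sum_mono)
      fix i
      show "v (of_int (c i) * x ^ i) \<le> v x ^ i"
        using int[of "c i"] gt
        by (simp add: absolute_value_mult[OF v] absolute_value_power[OF v] absolute_value_nonneg[OF v] mult_left_le_one_le)
    qed
    finally show ?thesis .
  qed
  moreover obtain N where "(\<Sum>i<m. v x ^ i) < v x ^ N" using real_arch_pow[OF gt] by blast
  ultimately show False by (meson not_less)
qed

lemma padic_abs_of_int_le_1: "Factorial_Ring.prime p \<Longrightarrow> padic_abs p (of_int k) \<le> 1"
  using one_le_power[of "real p" "multiplicity (int p) k"]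
  by (auto simp: padic_abs_def quotient_of_int power_int_minus inverse_le_1_iff Suc_le_eq prime_gt_0_nat)

lemma rational_sequence:
  obtains q :: "nat \<Rightarrow> rat" where "(\<lambda>n. real_of_rat (q n)) \<longlonglongrightarrow> r"
proof -
  have "\<exists>q. r < of_rat q \<and> of_rat q < r + 1 / (real n + 1)" for n
    by (rule of_rat_dense) simp
  then obtain q where q: "\<And>n. r < of_rat (q n)" "\<And>n. of_rat (q n) < r + 1 / (real n + 1)" by metis
  have "(\<lambda>n. real_of_rat (q n)) \<longlonglongrightarrow> r"
  proof (rule tendsto_sandwich[of "\<lambda>_. r" _ _ "\<lambda>n. r + 1 / (real n + 1)"])
    show "(\<lambda>n. r + 1 / (real n + 1)) \<longlonglongrightarrow> r"
      using tendsto_add[OF tendsto_const[of r] LIMSEQ_inverse_real_of_nat]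
      by (simp add: inverse_eq_divide add.commute)
  qed (use q in \<open>auto simp: less_imp_le\<close>)
  then show ?thesis using that by blast
qed

lemma tendsto_zero_bounded:
  fixes a b :: "nat \<Rightarrow> real"
  assumes "b \<longlonglongrightarrow> 0" "\<And>n. \<bar>a n\<bar> \<le> b n"
  shows "a \<longlonglongrightarrow> 0"
  by (rule tendsto_rabs_zero_cancel, rule tendsto_sandwich[OF _ _ tendsto_const assms(1)])
    (simp_all add: assms(2))

lemma complex_of_rat_real: "(of_rat q :: complex) = complex_of_real (real_of_rat q)"
  by (cases q) (simp add: of_rat_rat)

lemma tendsto_coeff_prod_linear:
  fixes Z :: "complex set"
  assumes "finite Z" "\<And>z. z \<in> Z \<Longrightarrow> (\<lambda>n. of_rat (q z n)) \<longlonglongrightarrow> z"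
  shows "(\<lambda>n. of_rat (Polynomial.coeff (\<Prod>z\<in>Z. [:- q z n, 1:]) i)) \<longlonglongrightarrow> Polynomial.coeff (\<Prod>z\<in>Z. [:- z, 1:]) i"
  using assms
proof (induction Z arbitrary: i)
  case (insert z Z)
  have IH: "(\<lambda>n. of_rat (Polynomial.coeff (\<Prod>z\<in>Z. [:- q z n, 1:]) i)) \<longlonglongrightarrow> Polynomial.coeff (\<Prod>z\<in>Z. [:- z, 1:]) i" for i
    using insert by blast
  have z: "(\<lambda>n. of_rat (q z n)) \<longlonglongrightarrow> z" using insert by blast
  show ?case
    using tendsto_diff[OF tendsto_const tendsto_mult[OF z IH[of 0]], of 0]
      tendsto_diff[OF IH[of "i - 1"] tendsto_mult[OF z IH[of i]]]
    by (cases i) (simp_all add: insert.hyps of_rat_diff of_rat_mult of_rat_minus)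
qed (auto simp: coeff_pCons one_pCons split: nat.split)

lemma rpoly_altdef_le:
  assumes "Polynomial.degree p \<le> D"
  shows "rpoly p x = (\<Sum>i\<le>D. of_rat (Polynomial.coeff p i) * x ^ i)"
  unfolding rpoly_altdef
  by (rule sum.mono_neutral_left) (use assms in \<open>auto simp: coeff_eq_0\<close>)

text \<open>
  Let \<open>z\<close> run through the roots of \<open>m\<close> and approximate each \<open>z\<close> by rational numbers
  \<open>q z n\<close>. The rational polynomials \<open>P n\<close> with these approximations as roots converge to \<open>m\<close>
  coefficientwise, so \<open>v\<close> of \<open>P n\<close> at \<open>\<theta>\<close> tends to \<open>0\<close>. It is a product of the factors
  \<open>v (\<theta> - q z n)\<close>, each of which converges, because the sequences \<open>q z\<close> are Cauchy and
  \<open>v\<close> is the usual absolute value on the rationals. Hence one of the limits is \<open>0\<close>.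
\<close>

lemma archimedean_root_limit:
  fixes v :: "'k::field_char_0 \<Rightarrow> real"
  assumes v: "absolute_value v" and arch: "\<And>q. v (of_rat q) = \<bar>real_of_rat q\<bar>"
    and m: "is_minpoly m \<theta>" and real: "\<And>z::complex. rpoly m z = 0 \<Longrightarrow> z \<in> \<real>"
  obtains z q where "rpoly m z = 0" "(\<lambda>n. of_rat (q n)) \<longlonglongrightarrow> (z::complex)"
    "(\<lambda>n. v (\<theta> - of_rat (q n))) \<longlonglongrightarrow> 0"
proof -
  define Z where "Z = {z::complex. rpoly m z = 0}"
  note dec = minpoly_complex_decompose[OF m, folded Z_def]
  define lc where "lc = Polynomial.lead_coeff m"
  have m0: "m \<noteq> 0" "rpoly m \<theta> = 0" using m by (auto simp: is_minpoly_def)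
  have lc0: "lc \<noteq> 0" using m0 by (simp add: lc_def)
  have "\<exists>q. (\<lambda>n. of_rat (q n)) \<longlonglongrightarrow> z" if "z \<in> Z" for z
  proof -
    have "z \<in> \<real>" using real that by (simp add: Z_def)
    then obtain r where r: "z = complex_of_real r" by (rule Reals_cases)
    obtain q where "(\<lambda>n. real_of_rat (q n)) \<longlonglongrightarrow> r" using rational_sequence .
    then show ?thesis unfolding r complex_of_rat_real by (intro exI[of _ q] tendsto_of_real)
  qed
  then obtain q where q: "\<And>z. z \<in> Z \<Longrightarrow> (\<lambda>n. of_rat (q z n)) \<longlonglongrightarrow> z" by metis
  define P where "P n = Polynomial.smult lc (\<Prod>z\<in>Z. [:- q z n, 1:])" for n
  have degP: "Polynomial.degree (P n) = Polynomial.degree m" for n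
    using lc0 dec(2) by (simp add: P_def degree_prod_sum_eq)
  have coeffP: "(\<lambda>n. real_of_rat (Polynomial.coeff (P n - m) i)) \<longlonglongrightarrow> 0" for i
  proof -
    have "(\<lambda>n. of_rat lc * of_rat (Polynomial.coeff (\<Prod>z\<in>Z. [:- q z n, 1:]) i) - of_rat (Polynomial.coeff m i))
        \<longlonglongrightarrow> of_rat lc * Polynomial.coeff (\<Prod>z\<in>Z. [:- z, 1:]) i - (of_rat (Polynomial.coeff m i) :: complex)"
      by (intro tendsto_intros tendsto_coeff_prod_linear dec(1) q)
    moreover have "of_rat (Polynomial.coeff m i) = of_rat lc * Polynomial.coeff (\<Prod>z\<in>Z. [:- z, 1:]) i"
      using arg_cong[OF dec(3), of "\<lambda>p. Polynomial.coeff p i"] by (simp add: coeff_map_poly lc_def)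
    ultimately have "(\<lambda>n. of_rat (Polynomial.coeff (P n - m) i)) \<longlonglongrightarrow> complex_of_real 0"
      by (simp add: P_def of_rat_diff of_rat_mult)
    then show ?thesis unfolding complex_of_rat_real by (simp only: tendsto_of_real_iff)
  qed
  have "(\<lambda>n. v (rpoly (P n) \<theta>)) \<longlonglongrightarrow> 0"
  proof (rule tendsto_sandwich)
    show "\<forall>\<^sub>F n in sequentially. 0 \<le> v (rpoly (P n) \<theta>)" by (simp add: absolute_value_nonneg[OF v])
    show "\<forall>\<^sub>F n in sequentially. v (rpoly (P n) \<theta>)
        \<le> (\<Sum>i\<le>Polynomial.degree m. \<bar>real_of_rat (Polynomial.coeff (P n - m) i)\<bar> * v \<theta> ^ i)"
    proof (intro always_eventually allI)
      fix n
      have "rpoly (P n) \<theta> = (\<Sum>i\<le>Polynomial.degree m. of_rat (Polynomial.coeff (P n - m) i) * \<theta> ^ i)"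
        using m0 rpoly_altdef_le[of "P n - m" "Polynomial.degree m" \<theta>] degree_diff_le[of "P n" _ m] degP
        by simp
      then show "v (rpoly (P n) \<theta>) \<le> (\<Sum>i\<le>Polynomial.degree m. \<bar>real_of_rat (Polynomial.coeff (P n - m) i)\<bar> * v \<theta> ^ i)"
        using absolute_value_sum[OF v, of "\<lambda>i. of_rat (Polynomial.coeff (P n - m) i) * \<theta> ^ i" "{..Polynomial.degree m}"]
        by (simp add: absolute_value_mult[OF v] absolute_value_power[OF v] arch)
    qed
    have "(\<lambda>n. \<Sum>i\<le>Polynomial.degree m. \<bar>real_of_rat (Polynomial.coeff (P n - m) i)\<bar> * v \<theta> ^ i)
        \<longlonglongrightarrow> (\<Sum>i\<le>Polynomial.degree m. \<bar>0\<bar> * v \<theta> ^ i)"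
      by (intro tendsto_intros coeffP)
    then show "(\<lambda>n. \<Sum>i\<le>Polynomial.degree m. \<bar>real_of_rat (Polynomial.coeff (P n - m) i)\<bar> * v \<theta> ^ i) \<longlonglongrightarrow> 0"
      by simp
  qed simp
  moreover have "v (rpoly (P n) \<theta>) = \<bar>real_of_rat lc\<bar> * (\<Prod>z\<in>Z. v (\<theta> - of_rat (q z n)))" for n
  proof -
    have "rpoly (\<Prod>z\<in>Z. [:- q z n, 1:]) \<theta> = (\<Prod>z\<in>Z. \<theta> - of_rat (q z n))"
      using dec(1) by (induction Z) (simp_all add: of_rat_minus algebra_simps)
    then show ?thesis by (simp add: P_def absolute_value_mult[OF v] absolute_value_prod[OF v] arch)
  qed
  ultimately have lim0: "(\<lambda>n. \<bar>real_of_rat lc\<bar> * (\<Prod>z\<in>Z. v (\<theta> - of_rat (q z n)))) \<longlonglongrightarrow> 0" by simp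
  have "convergent (\<lambda>n. v (\<theta> - of_rat (q z n)))" if "z \<in> Z" for z
  proof -
    have cau: "Cauchy (\<lambda>n. of_rat (q z n) :: complex)" using q[OF that] by (rule LIMSEQ_imp_Cauchy)
    have "dist (v (\<theta> - of_rat (q z i))) (v (\<theta> - of_rat (q z j)))
        \<le> dist (of_rat (q z i) :: complex) (of_rat (q z j))" for i j
    proof -
      have "dist (of_rat (q z i) :: complex) (of_rat (q z j)) = \<bar>real_of_rat (q z j - q z i)\<bar>"
        by (simp add: complex_of_rat_real dist_real_def of_rat_diff)
      also have "\<dots> = v ((\<theta> - of_rat (q z i)) - (\<theta> - of_rat (q z j)))"
        by (subst arch[symmetric]) (simp add: of_rat_diff)
      finally have eq: "dist (of_rat (q z i) :: complex) (of_rat (q z j))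
          = v ((\<theta> - of_rat (q z i)) - (\<theta> - of_rat (q z j)))" .
      show ?thesis unfolding eq dist_real_def by (rule absolute_value_diff[OF v])
    qed
    note le = this
    have "Cauchy (\<lambda>n. v (\<theta> - of_rat (q z n)))"
    proof (rule metric_CauchyI)
      fix e :: real assume "e > 0"
      then obtain M where M: "\<And>i j. i \<ge> M \<Longrightarrow> j \<ge> M \<Longrightarrow> dist (of_rat (q z i) :: complex) (of_rat (q z j)) < e"
        using metric_CauchyD[OF cau] by blast
      show "\<exists>M. \<forall>i\<ge>M. \<forall>j\<ge>M. dist (v (\<theta> - of_rat (q z i))) (v (\<theta> - of_rat (q z j))) < e"
        by (intro exI[of _ M] allI impI le_less_trans[OF le] M)
    qed
    then show ?thesis by (simp add: Cauchy_convergent_iff)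
  qed
  then have "\<forall>z\<in>Z. \<exists>L. (\<lambda>n. v (\<theta> - of_rat (q z n))) \<longlonglongrightarrow> L" by (auto simp: convergent_def)
  then obtain L where L: "\<And>z. z \<in> Z \<Longrightarrow> (\<lambda>n. v (\<theta> - of_rat (q z n))) \<longlonglongrightarrow> L z" by metis
  have "(\<lambda>n. \<bar>real_of_rat lc\<bar> * (\<Prod>z\<in>Z. v (\<theta> - of_rat (q z n)))) \<longlonglongrightarrow> \<bar>real_of_rat lc\<bar> * (\<Prod>z\<in>Z. L z)"
    by (intro tendsto_intros L)
  then have "\<bar>real_of_rat lc\<bar> * (\<Prod>z\<in>Z. L z) = 0" using lim0 by (rule LIMSEQ_unique)
  then obtain z where "z \<in> Z" "L z = 0" using lc0 dec(1) by auto
  then show ?thesis using that[of z "q z"] q L[of z] by (simp add: Z_def)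
qed

lemma rpoly_of_rat: "rpoly g (of_rat r) = of_rat (poly g r)"
  by (induction g) (simp_all add: of_rat_add of_rat_mult)

text \<open>
  If the rationals \<open>q n\<close> tend to \<open>\<theta>\<close> with respect to \<open>v\<close> and to \<open>z\<close> in the complex numbers, then
  \<open>g (q n)\<close> tends to \<open>g \<theta>\<close> and to \<open>g z\<close>, respectively. Since \<open>v\<close> is the usual absolute value
  on the rationals, \<open>v (g \<theta>) = |g z|\<close>, and \<open>z\<close> is the image of \<open>\<theta>\<close> under an embedding.
\<close>

theorem archimedean_absolute_value:
  fixes v :: "'k::field_char_0 \<Rightarrow> real"
  assumes K: "number_field TYPE('k)" and tr: "totally_real TYPE('k)"
    and v: "absolute_value v" and arch: "\<And>q. v (of_rat q) = \<bar>real_of_rat q\<bar>"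
  obtains \<sigma> :: "'k::field_char_0 \<Rightarrow> complex" where "\<sigma> \<in> field_embeddings" "v = (\<lambda>x. cmod (\<sigma> x))"
proof -
  obtain \<theta> :: 'k where \<theta>: "range (\<lambda>p. rpoly p \<theta>) = UNIV" using primitive_element[OF K] .
  obtain m where m: "is_minpoly m \<theta>" using number_field_algebraic[OF K] minpoly_exists by metis
  have real: "z \<in> \<real>" if z: "rpoly m z = 0" for z :: complex
  proof -
    obtain \<sigma> :: "'k \<Rightarrow> complex" where "\<sigma> \<in> field_embeddings" "\<sigma> \<theta> = z"
      using embedding_of_root[OF \<theta> m z] .
    then show ?thesis using tr unfolding totally_real_def by blast
  qed
  obtain z q where z: "rpoly m z = 0" "(\<lambda>n. of_rat (q n)) \<longlonglongrightarrow> (z::complex)"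
    "(\<lambda>n. v (\<theta> - of_rat (q n))) \<longlonglongrightarrow> 0"
    using archimedean_root_limit[OF v arch m real] by blast
  obtain \<sigma> :: "'k \<Rightarrow> complex" where \<sigma>: "\<sigma> \<in> field_embeddings" "\<sigma> \<theta> = z"
    using embedding_of_root[OF \<theta> m z(1)] .
  have lim: "(\<lambda>n. rpoly g (of_rat (q n))) \<longlonglongrightarrow> rpoly g z" for g
  proof (induction g)
    case (pCons a g)
    have "(\<lambda>n. of_rat a + of_rat (q n) * rpoly g (of_rat (q n))) \<longlonglongrightarrow> of_rat a + z * rpoly g z"
      by (rule tendsto_add[OF tendsto_const tendsto_mult[OF z(2) pCons.IH]])
    then show ?case by simp
  qed simp
  have cm: "cmod (rpoly g (of_rat r)) = v (of_rat (poly g r))" for g r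
    by (simp only: rpoly_of_rat arch) (simp add: complex_of_rat_real)
  have diff: "(\<lambda>n. v (rpoly g \<theta> - of_rat (poly g (q n)))) \<longlonglongrightarrow> 0" for g
  proof (induction g)
    case 0
    then show ?case using absolute_value_eq_0[OF v, of 0] by simp
  next
    case (pCons a g)
    define b where "b n = v \<theta> * v (rpoly g \<theta> - of_rat (poly g (q n)))
        + v (\<theta> - of_rat (q n)) * cmod (rpoly g (of_rat (q n)))" for n
    have "b \<longlonglongrightarrow> v \<theta> * 0 + 0 * cmod (rpoly g z)"
      unfolding b_def
      by (rule tendsto_add[OF tendsto_mult[OF tendsto_const pCons.IH] tendsto_mult[OF z(3) tendsto_norm[OF lim]]])
    then have b: "b \<longlonglongrightarrow> 0" by simp
    have le: "v (rpoly (pCons a g) \<theta> - of_rat (poly (pCons a g) (q n))) \<le> b n" for n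
    proof -
      have "rpoly (pCons a g) \<theta> - of_rat (poly (pCons a g) (q n))
          = \<theta> * (rpoly g \<theta> - of_rat (poly g (q n))) + (\<theta> - of_rat (q n)) * of_rat (poly g (q n))"
        by (simp add: of_rat_add of_rat_mult algebra_simps)
      then show ?thesis
        using absolute_value_add[OF v, of "\<theta> * (rpoly g \<theta> - of_rat (poly g (q n)))" "(\<theta> - of_rat (q n)) * of_rat (poly g (q n))"]
        by (simp add: absolute_value_mult[OF v] cm b_def)
    qed
    show ?case
    proof (rule tendsto_zero_bounded[OF b])
      fix n
      show "\<bar>v (rpoly (pCons a g) \<theta> - of_rat (poly (pCons a g) (q n)))\<bar> \<le> b n"
        unfolding abs_of_nonneg[OF absolute_value_nonneg[OF v]] by (rule le)
    qed
  qed
  have "v (rpoly g \<theta>) = cmod (\<sigma> (rpoly g \<theta>))" for g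
  proof -
    have "(\<lambda>n. v (rpoly g \<theta>) - cmod (rpoly g (of_rat (q n)))) \<longlonglongrightarrow> 0"
    proof (rule tendsto_zero_bounded[OF diff[of g]])
      fix n
      show "\<bar>v (rpoly g \<theta>) - cmod (rpoly g (of_rat (q n)))\<bar> \<le> v (rpoly g \<theta> - of_rat (poly g (q n)))"
        using absolute_value_diff[OF v, of "rpoly g \<theta>" "of_rat (poly g (q n))"]
        by (simp add: cm)
    qed
    moreover have "(\<lambda>n. v (rpoly g \<theta>) - cmod (rpoly g (of_rat (q n)))) \<longlonglongrightarrow> v (rpoly g \<theta>) - cmod (rpoly g z)"
      by (rule tendsto_diff[OF tendsto_const tendsto_norm[OF lim]])
    ultimately have "0 = v (rpoly g \<theta>) - cmod (rpoly g z)" by (rule LIMSEQ_unique)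
    then show ?thesis by (simp add: embedding_rpoly[OF \<sigma>(1)] \<sigma>(2))
  qed
  note * = this
  have "v x = cmod (\<sigma> x)" for x
  proof -
    have "x \<in> range (\<lambda>p. rpoly p \<theta>)" unfolding \<theta> by (rule UNIV_I)
    then obtain g where "x = rpoly g \<theta>" by (rule rangeE)
    then show ?thesis using *[of g] by simp
  qed
  then show ?thesis by (intro that[OF \<sigma>(1)] ext)
qed

lemma absolute_value_embedding:
  assumes "\<sigma> \<in> (field_embeddings :: ('k::field_char_0 \<Rightarrow> complex) set)"
  shows "absolute_value (\<lambda>x. cmod (\<sigma> x))"
  unfolding absolute_value_def
  by (simp add: embedding_simps[OF assms] norm_mult norm_triangle_ineq)

lemma embedding_place:
  assumes "\<sigma> \<in> (field_embeddings :: ('k::field_char_0 \<Rightarrow> complex) set)"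
  shows "(\<lambda>x. cmod (\<sigma> x)) \<in> places"
  unfolding places_def
  using absolute_value_embedding[OF assms] by (simp add: embedding_of_rat[OF assms] complex_of_rat_real)

text \<open>
  The real numbers \<open>\<sigma> x\<close> and \<open>\<tau> x\<close> have equal absolute values, and so have \<open>\<sigma> x + 1\<close> and
  \<open>\<tau> x + 1\<close>; this excludes \<open>\<sigma> x = - \<tau> x\<close> unless both vanish.
\<close>

lemma inj_on_embedding_place:
  assumes "totally_real TYPE('k::field_char_0)"
  shows "inj_on (\<lambda>\<sigma> x. cmod (\<sigma> x)) (field_embeddings :: ('k \<Rightarrow> complex) set)"
proof (intro inj_onI ext)
  fix \<sigma> \<tau> :: "'k \<Rightarrow> complex" and x
  assume \<sigma>: "\<sigma> \<in> field_embeddings" and \<tau>: "\<tau> \<in> field_embeddings"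
    and eq: "(\<lambda>x. cmod (\<sigma> x)) = (\<lambda>x. cmod (\<tau> x))"
  have real: "\<sigma> x \<in> \<real>" "\<tau> x \<in> \<real>" using assms \<sigma> \<tau> unfolding totally_real_def by blast+
  define a b where "a = Re (\<sigma> x)" and "b = Re (\<tau> x)"
  have ab: "\<sigma> x = complex_of_real a" "\<tau> x = complex_of_real b"
    using real by (simp_all add: a_def b_def of_real_Re)
  have "cmod (complex_of_real (a + 1)) = cmod (complex_of_real (b + 1))"
    using fun_cong[OF eq, of "x + 1"] by (simp add: ab embedding_simps[OF \<sigma>] embedding_simps[OF \<tau>])
  moreover have "cmod (complex_of_real a) = cmod (complex_of_real b)"
    using fun_cong[OF eq, of x] by (simp only: ab)
  ultimately have "\<bar>a + 1\<bar> = \<bar>b + 1\<bar>" "\<bar>a\<bar> = \<bar>b\<bar>" by (simp_all only: norm_of_real)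
  then have "a = b" by linarith
  then show "\<sigma> x = \<tau> x" by (simp add: ab)
qed

section \<open>The local degree of a real place\<close>

text \<open>
  Through \<open>\<rho>\<close>, the Cauchy sequences for \<open>v\<close> are the sequences whose images converge in the
  real numbers. Taking limits identifies the completion with the field of real numbers, in which
  the rational numbers are dense.
\<close>

locale real_place =
  fixes \<rho> :: "'k::field_char_0 \<Rightarrow> real" and v :: "'k \<Rightarrow> real"
  assumes \<rho>: "\<rho> \<in> field_embeddings" and v_def: "v = (\<lambda>x. \<bar>\<rho> x\<bar>)"
begin

lemmas \<rho>_simps = embedding_simps[OF \<rho>]

lemma cauchy_ring_carrier: "s \<in> carrier (cauchy_ring v) \<longleftrightarrow> convergent (\<lambda>n. \<rho> (s n))"
  by (simp add: cauchy_ring_def v_def Cauchy_convergent_iff[symmetric] Cauchy_def dist_real_def \<rho>_simps)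

lemma null_sequences_iff: "s \<in> null_sequences v \<longleftrightarrow> (\<lambda>n. \<rho> (s n)) \<longlonglongrightarrow> 0"
  by (simp add: null_sequences_def v_def tendsto_rabs_zero_iff)

lemma cauchy_ring_simps [simp]:
  "s \<oplus>\<^bsub>cauchy_ring v\<^esub> t = (\<lambda>n. s n + t n)" "s \<otimes>\<^bsub>cauchy_ring v\<^esub> t = (\<lambda>n. s n * t n)"
  "\<zero>\<^bsub>cauchy_ring v\<^esub> = (\<lambda>_. 0)" "\<one>\<^bsub>cauchy_ring v\<^esub> = (\<lambda>_. 1)"
  by (simp_all add: cauchy_ring_def)

lemma ring_cauchy_ring: "ring (cauchy_ring v)"
proof (rule ringI)
  show "abelian_group (cauchy_ring v)"
  proof (rule abelian_groupI)
    fix s assume "s \<in> carrier (cauchy_ring v)"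
    then show "\<exists>t\<in>carrier (cauchy_ring v). t \<oplus>\<^bsub>cauchy_ring v\<^esub> s = \<zero>\<^bsub>cauchy_ring v\<^esub>"
      by (intro bexI[of _ "\<lambda>n. - s n"])
        (simp_all add: cauchy_ring_carrier \<rho>_simps convergent_minus_iff[symmetric])
  qed (auto simp: cauchy_ring_carrier \<rho>_simps add_ac intro: convergent_add convergent_const)
  show "Group.monoid (cauchy_ring v)"
    by (rule monoidI) (auto simp: cauchy_ring_carrier \<rho>_simps mult_ac intro: convergent_mult convergent_const)
qed (auto simp: algebra_simps)

definition limit_map :: "(nat \<Rightarrow> 'k) \<Rightarrow> real" where
  "limit_map s = lim (\<lambda>n. \<rho> (s n))"

lemma limit_map:
  assumes "s \<in> carrier (cauchy_ring v)"
  shows "(\<lambda>n. \<rho> (s n)) \<longlonglongrightarrow> limit_map s"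
  using assms by (simp add: cauchy_ring_carrier limit_map_def convergent_LIMSEQ_iff)

lemma limit_map_eqI:
  assumes "(\<lambda>n. \<rho> (s n)) \<longlonglongrightarrow> L"
  shows "s \<in> carrier (cauchy_ring v)" "limit_map s = L"
  using assms by (auto simp: cauchy_ring_carrier limit_map_def convergent_def limI)

abbreviation "\<R> \<equiv> (ring_of_type_algebra :: real ring)"

lemma ring_hom_limit_map: "ring_hom_ring (cauchy_ring v) \<R> limit_map"
proof (rule ring_hom_ringI2[OF ring_cauchy_ring])
  show "ring \<R>" by (rule ring_from_type_algebra)
  show "limit_map \<in> Ring.ring_hom (cauchy_ring v) \<R>"
  proof (rule ring_hom_memI)
    fix s t assume "s \<in> carrier (cauchy_ring v)" "t \<in> carrier (cauchy_ring v)"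
    note lims = limit_map[OF this(1)] limit_map[OF this(2)]
    show "limit_map (s \<otimes>\<^bsub>cauchy_ring v\<^esub> t) = limit_map s \<otimes>\<^bsub>\<R>\<^esub> limit_map t"
      using limit_map_eqI(2)[of "\<lambda>n. s n * t n"] tendsto_mult[OF lims]
      by (simp add: \<rho>_simps ring_of_type_algebra_def)
    show "limit_map (s \<oplus>\<^bsub>cauchy_ring v\<^esub> t) = limit_map s \<oplus>\<^bsub>\<R>\<^esub> limit_map t"
      using limit_map_eqI(2)[of "\<lambda>n. s n + t n"] tendsto_add[OF lims]
      by (simp add: \<rho>_simps ring_of_type_algebra_def)
  next
    show "limit_map \<one>\<^bsub>cauchy_ring v\<^esub> = \<one>\<^bsub>\<R>\<^esub>"
      using limit_map_eqI(2)[of "\<lambda>_. 1"] by (simp add: \<rho>_simps ring_of_type_algebra_def)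
  qed (simp add: ring_of_type_algebra_def)
qed

lemma kernel_limit_map: "a_kernel (cauchy_ring v) \<R> limit_map = null_sequences v"
  unfolding a_kernel_def'
  using limit_map_eqI by (auto simp: null_sequences_iff ring_of_type_algebra_def) (metis limit_map)

lemma rational_sequence_limit:
  obtains s where "range s \<subseteq> \<rat>" "s \<in> carrier (cauchy_ring v)" "limit_map s = L"
proof -
  obtain q where q: "(\<lambda>n. real_of_rat (q n)) \<longlonglongrightarrow> L" by (rule rational_sequence)
  show ?thesis
    by (rule that[of "\<lambda>n. of_rat (q n)"]) (use limit_map_eqI[of "\<lambda>n. of_rat (q n)" L] q in \<open>auto simp: \<rho>_simps\<close>)
qed

text \<open>
  The null sequences are the kernel of the limit homomorphism, which is onto already on rational
  sequences.
\<close>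

lemma field_completion: "field (completion v)"
proof -
  interpret h: ring_hom_ring "cauchy_ring v" \<R> limit_map by (rule ring_hom_limit_map)
  have "y \<in> limit_map ` carrier (cauchy_ring v)" for y
    by (rule rational_sequence_limit[of y]) blast
  then have "limit_map ` carrier (cauchy_ring v) = carrier \<R>"
    by (auto simp: ring_of_type_algebra_def)
  then have iso: "completion v \<simeq> \<R>"
    using h.FactRing_iso by (simp add: completion_def kernel_limit_map)
  have rc: "ring (completion v)"
    using ideal.quotient_is_ring[OF h.kernel_is_ideal] by (simp add: completion_def kernel_limit_map)
  obtain g where g: "g \<in> ring_iso \<R> (completion v)"
    using ring_iso_sym[OF rc iso] by (auto simp: is_ring_iso_def)
  interpret F: field \<R> by (rule field_from_type_algebra)
  interpret g: ring_hom_ring \<R> "completion v" g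
    using g by (intro ring_hom_ringI2 ring_from_type_algebra rc) (simp add: ring_iso_def)
  show ?thesis using F.ring_iso_imp_img_field[OF g] by simp
qed

text \<open>
  Every Cauchy sequence differs by a null sequence from a rational sequence with the same limit.
\<close>

lemma rat_completion_eq: "rat_completion v = carrier (completion v)"
proof -
  have "\<exists>t. null_sequences v +>\<^bsub>cauchy_ring v\<^esub> s = null_sequences v +>\<^bsub>cauchy_ring v\<^esub> t \<and>
      t \<in> carrier (cauchy_ring v) \<and> range t \<subseteq> \<rat>" if s: "s \<in> carrier (cauchy_ring v)" for s
  proof -
    obtain t where t: "range t \<subseteq> \<rat>" "t \<in> carrier (cauchy_ring v)" "limit_map t = limit_map s"
      by (rule rational_sequence_limit)
    have lim: "(\<lambda>n. \<rho> (s n) - \<rho> (t n)) \<longlonglongrightarrow> 0"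
      using tendsto_diff[OF limit_map[OF s] limit_map[OF t(2)]] t(3) by simp
    have 1: "(\<lambda>n. h n + s n) \<in> null_sequences v +>\<^bsub>cauchy_ring v\<^esub> t" if "h \<in> null_sequences v" for h
    proof -
      have "(\<lambda>n. h n + s n - t n) \<in> null_sequences v"
        using tendsto_add[OF that[unfolded null_sequences_iff] lim]
        by (simp add: null_sequences_iff \<rho>_simps add_diff_eq)
      then show ?thesis unfolding a_r_coset_def' by (force intro!: bexI)
    qed
    have 2: "(\<lambda>n. h n + t n) \<in> null_sequences v +>\<^bsub>cauchy_ring v\<^esub> s" if "h \<in> null_sequences v" for h
    proof -
      have "(\<lambda>n. h n + t n - s n) \<in> null_sequences v"
        using tendsto_diff[OF that[unfolded null_sequences_iff] lim]
        by (simp add: null_sequences_iff \<rho>_simps algebra_simps)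
      then show ?thesis unfolding a_r_coset_def' by (force intro!: bexI)
    qed
    have "null_sequences v +>\<^bsub>cauchy_ring v\<^esub> s = null_sequences v +>\<^bsub>cauchy_ring v\<^esub> t"
      using 1 2 by (auto simp: a_r_coset_def'[of _ _ s] a_r_coset_def'[of _ _ t])
    then show ?thesis using t by blast
  qed
  then show ?thesis
    unfolding rat_completion_def completion_def FactRing_def A_RCOSETS_def' by auto
qed

lemma local_degree_eq_1: "local_degree v = 1"
proof -
  interpret field "completion v" by (rule field_completion)
  have "(dim over carrier (completion v)) (carrier (completion v)) = 1"
    by (rule dimI[OF carrier_is_subfield dimension_one[OF carrier_is_subfield]])
  then show ?thesis by (simp add: local_degree_def rat_completion_eq over_def)
qed

end

section \<open>The height of a tuple of integers\<close>

lemma local_degree_embedding: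
  assumes "totally_real TYPE('k::field_char_0)" "\<sigma> \<in> (field_embeddings :: ('k \<Rightarrow> complex) set)"
  shows "local_degree (\<lambda>x. cmod (\<sigma> x)) = 1"
proof -
  have real: "\<sigma> x = complex_of_real (Re (\<sigma> x))" for x
    using assms unfolding totally_real_def by (metis of_real_Re range_subsetD)
  have mult: "Im (\<sigma> x) = 0" for x using real[of x] by (metis Im_complex_of_real)
  interpret real_place "\<lambda>x. Re (\<sigma> x)" "\<lambda>x. cmod (\<sigma> x)"
  proof
    show "(\<lambda>x. Re (\<sigma> x)) \<in> field_embeddings"
      by (simp add: field_embeddings_def embedding_simps[OF assms(2)] mult)
    have "cmod (\<sigma> x) = \<bar>Re (\<sigma> x)\<bar>" for x by (metis norm_of_real real)
    then show "(\<lambda>x. cmod (\<sigma> x)) = (\<lambda>x. \<bar>Re (\<sigma> x)\<bar>)" by simp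
  qed
  show ?thesis by (rule local_degree_eq_1)
qed

lemma local_height_ge:
  shows local_height_ge_1: "local_height v n a \<ge> 1"
    and local_height_ge_abs: "i \<in> {1..n} \<Longrightarrow> normalized_abs v (a i) \<le> local_height v n a"
  unfolding local_height_def by (rule Max_ge; simp)+

lemma local_height_finite_place:
  assumes "v \<in> places" "\<not> (\<forall>q. v (of_rat q) = \<bar>real_of_rat q\<bar>)"
    and a: "\<And>i. i \<in> {1..n} \<Longrightarrow> a i \<in> ring_of_integers"
  shows "local_height v n a = 1"
proof -
  obtain p where v: "absolute_value v" and p: "Factorial_Ring.prime p" "\<And>q. v (of_rat q) = padic_abs p q"
    using assms by (auto simp: places_def)
  have "v (of_int k) \<le> 1" for k
    using padic_abs_of_int_le_1[OF p(1), of k] p(2)[of "of_int k"] by simp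
  then have "v (a i) \<le> 1" if "i \<in> {1..n}" for i
    using absolute_value_algebraic_int_le_1[OF v] a[OF that] by (simp add: ring_of_integers_def)
  then have "normalized_abs v (a i) \<le> 1" if "i \<in> {1..n}" for i
    using that absolute_value_nonneg[OF v] by (simp add: normalized_abs_def power_le_one)
  then show ?thesis unfolding local_height_def by (intro Max_eqI) auto
qed

text \<open>
  Integers contribute only at archimedean places, and those correspond to the embeddings. The
  index set of the product defining the height may be smaller than the set of these places, but only by
  places whose factor is \<open>1\<close>.
\<close>

theorem field_height_eq_prod_embeddings:
  assumes K: "number_field TYPE('k::field_char_0)" and tr: "totally_real TYPE('k)"
    and a: "\<And>i. i \<in> {1..n} \<Longrightarrow> (a i :: 'k) \<in> ring_of_integers"
  shows "field_height n a = (\<Prod>\<sigma>\<in>(field_embeddings :: ('k \<Rightarrow> complex) set). local_height (\<lambda>x. cmod (\<sigma> x)) n a)"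
proof -
  define E where "E = (field_embeddings :: ('k \<Rightarrow> complex) set)"
  define I where "I = (\<lambda>\<sigma> x. cmod (\<sigma> x)) ` E"
  have finE: "finite E" unfolding E_def by (rule card_complex_embeddings[OF K])
  have "v \<in> I" if v: "v \<in> places" "local_height v n a \<noteq> 1" for v
  proof -
    have arch: "v (of_rat q) = \<bar>real_of_rat q\<bar>" for q
      using local_height_finite_place[of v n a] v a by blast
    have "absolute_value v" using v(1) by (simp add: places_def)
    then obtain \<sigma> where "\<sigma> \<in> E" "v = (\<lambda>x. cmod (\<sigma> x))"
      unfolding E_def by (rule archimedean_absolute_value[OF K tr _ arch])
    then show ?thesis by (auto simp: I_def)
  qed
  then have "field_height n a = (\<Prod>v\<in>I. local_height v n a)"
    unfolding field_height_def using finE embedding_place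
    by (intro prod.mono_neutral_left) (auto simp: I_def E_def)
  also have "\<dots> = (\<Prod>\<sigma>\<in>E. local_height (\<lambda>x. cmod (\<sigma> x)) n a)"
    unfolding I_def E_def by (rule prod.reindex_cong[OF inj_on_embedding_place[OF tr]]) auto
  finally show ?thesis unfolding E_def .
qed

section \<open>Integral bases\<close>

lemma int_span_add: "x \<in> int_span I g \<Longrightarrow> y \<in> int_span I g \<Longrightarrow> x + y \<in> int_span I g"
  unfolding int_span_def
proof clarify
  fix x y :: "_ \<Rightarrow> int"
  show "\<exists>z. (\<Sum>i\<in>I. g i * of_int (x i)) + (\<Sum>i\<in>I. g i * of_int (y i)) = (\<Sum>i\<in>I. g i * of_int (z i)) \<and> True"
    by (rule exI[of _ "\<lambda>i. x i + y i"]) (simp add: sum.distrib algebra_simps)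
qed

lemma int_span_mult: "x \<in> int_span I g \<Longrightarrow> of_int k * x \<in> int_span I g"
  unfolding int_span_def
proof clarify
  fix x :: "_ \<Rightarrow> int"
  show "\<exists>z. of_int k * (\<Sum>i\<in>I. g i * of_int (x i)) = (\<Sum>i\<in>I. g i * of_int (z i)) \<and> True"
    by (rule exI[of _ "\<lambda>i. k * x i"]) (simp add: sum_distrib_left algebra_simps)
qed

lemma int_span_0: "0 \<in> int_span I g"
  unfolding int_span_def by (rule CollectI, rule exI[of _ "\<lambda>_. 0"]) simp

lemma int_span_base:
  assumes "finite I" "i \<in> I"
  shows "g i \<in> int_span I g"
proof -
  have "(\<Sum>j\<in>I. g j * of_int (if j = i then 1 else 0)) = (\<Sum>j\<in>I. if j = i then g j else 0)"
    by (rule sum.cong) auto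
  also have "\<dots> = g i" using assms by simp
  finally have "g i = (\<Sum>j\<in>I. g j * of_int (if j = i then 1 else 0))" by (rule sym)
  then show ?thesis unfolding int_span_def
    by (intro CollectI exI[of _ "\<lambda>j. if j = i then 1 else 0"]) simp
qed

lemma int_span_sum: "(\<And>j. j \<in> J \<Longrightarrow> f j \<in> int_span I g) \<Longrightarrow> (\<Sum>j\<in>J. f j) \<in> int_span I g"
  by (induction J rule: infinite_finite_induct) (auto simp: int_span_0 int_span_add)

lemma int_span_minimal:
  assumes "\<And>i. i \<in> J \<Longrightarrow> h i \<in> int_span I g"
  shows "int_span J h \<subseteq> int_span I g"
proof
  fix x assume "x \<in> int_span J h"
  then obtain c where "x = (\<Sum>i\<in>J. h i * of_int (c i))" by (auto simp: int_span_def)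
  then have "x = (\<Sum>i\<in>J. of_int (c i) * h i)" by (simp add: mult.commute)
  then show "x \<in> int_span I g" using assms by (auto intro!: int_span_sum int_span_mult)
qed

lemma int_span_shear:
  assumes "finite I" "i \<in> I" "j \<in> I" "i \<noteq> j"
  shows "int_span I (g(j := g j + of_int s * g i)) = int_span I g"
proof
  define h where "h = g(j := g j + of_int s * g i)"
  have "h k \<in> int_span I g" if "k \<in> I" for k
    using assms that by (auto simp: h_def intro!: int_span_add int_span_mult int_span_base)
  then show "int_span I h \<subseteq> int_span I g" by (rule int_span_minimal)
  have "h j + of_int (- s) * h i \<in> int_span I h"
    by (intro int_span_add int_span_mult int_span_base assms)
  then have "g j \<in> int_span I h" using assms by (simp add: h_def)
  moreover have "g k \<in> int_span I h" if "k \<in> I" "k \<noteq> j" for k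
    using int_span_base[OF assms(1) that(1), of h] that by (simp add: h_def)
  ultimately have "g k \<in> int_span I h" if "k \<in> I" for k using that by (cases "k = j") simp_all
  then show "int_span I g \<subseteq> int_span I h" by (rule int_span_minimal)
qed

lemma sum_remove_two:
  assumes "finite I" "i \<in> I" "j \<in> I" "i \<noteq> j"
  shows "sum f I = f i + (f j + sum f (I - {i} - {j}))"
  using assms sum.remove[of I i f] sum.remove[of "I - {i}" j f] by simp

text \<open>
  Euclid's algorithm on the coefficients of a relation: \<open>c\<^sub>i g\<^sub>i + c\<^sub>j g\<^sub>j\<close> equals
  \<open>(c\<^sub>i \<minusplus> c\<^sub>j) g\<^sub>i + c\<^sub>j (g\<^sub>j \<plusminus> g\<^sub>i)\<close>, so replacing a generator by a sum or difference of two
  makes the relation smaller and keeps the span. When only one coefficient is left, the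
  corresponding generator is zero and can be dropped.
\<close>

lemma redundant_generator:
  fixes g :: "'i \<Rightarrow> 'k::field_char_0"
  assumes I: "finite I" and rel: "(\<Sum>i\<in>I. g i * of_int (c i)) = 0" and c: "\<exists>i\<in>I. c i \<noteq> 0"
  shows "\<exists>h. \<exists>i\<in>I. int_span (I - {i}) h = int_span I g"
  using rel c
proof (induction "\<Sum>i\<in>I. nat \<bar>c i\<bar>" arbitrary: g c rule: less_induct)
  case less
  show ?case
  proof (cases "\<exists>i\<in>I. \<exists>j\<in>I. i \<noteq> j \<and> c i \<noteq> 0 \<and> c j \<noteq> 0")
    case False
    then obtain i where i: "i \<in> I" "c i \<noteq> 0" "\<And>j. j \<in> I \<Longrightarrow> j \<noteq> i \<Longrightarrow> c j = 0" using less.prems by blast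
    have "(\<Sum>j\<in>I. g j * of_int (c j)) = g i * of_int (c i)"
      unfolding sum.remove[OF I i(1)] by (simp add: i(3) cong: sum.cong_simp)
    then have gi: "g i = 0" using less.prems i by simp
    have "int_span (I - {i}) g \<subseteq> int_span I g"
      using I by (intro int_span_minimal int_span_base) auto
    moreover have "g j \<in> int_span (I - {i}) g" if "j \<in> I" for j
      using I gi int_span_0 int_span_base[of "I - {i}" j g] that by (cases "j = i") auto
    then have "int_span I g \<subseteq> int_span (I - {i}) g" by (rule int_span_minimal)
    ultimately show ?thesis using i(1) by blast
  next
    case True
    then obtain i j where ij': "i \<in> I" "j \<in> I" "i \<noteq> j" "c i \<noteq> 0" "c j \<noteq> 0" by blast
    obtain i j where ij: "i \<in> I" "j \<in> I" "i \<noteq> j" "c i \<noteq> 0" "c j \<noteq> 0" "\<bar>c j\<bar> \<le> \<bar>c i\<bar>"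
    proof (cases "\<bar>c j\<bar> \<le> \<bar>c i\<bar>")
      case True
      with ij' show ?thesis by (intro that)
    next
      case False
      with ij' show ?thesis by (intro that[of j i]) simp_all
    qed
    define s where "s = sgn (c i) * sgn (c j)"
    define h where "h = g(j := g j + of_int s * g i)"
    define c' where "c' = c(i := c i - s * c j)"
    have small: "\<bar>c i - s * c j\<bar> < \<bar>c i\<bar>"
      using ij(4,5,6) by (auto simp: s_def sgn_if)
    note rest = sum_remove_two[OF I ij(1-3)]
    have new: "c' i = c i - s * c j" "c' j = c j" "h i = g i" "h j = g j + of_int s * g i"
      using ij(3) by (simp_all add: c'_def h_def)
    have old: "c' k = c k" "h k = g k" if "k \<in> I - {i} - {j}" for k
      using that by (simp_all add: c'_def h_def)
    have "(\<Sum>k\<in>I - {i} - {j}. nat \<bar>c' k\<bar>) = (\<Sum>k\<in>I - {i} - {j}. nat \<bar>c k\<bar>)"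
      by (rule sum.cong) (simp_all only: old)
    then have "(\<Sum>k\<in>I. nat \<bar>c' k\<bar>) < (\<Sum>k\<in>I. nat \<bar>c k\<bar>)"
      using small unfolding rest new by linarith
    moreover have "(\<Sum>k\<in>I. h k * of_int (c' k)) = 0"
    proof -
      have "(\<Sum>k\<in>I - {i} - {j}. h k * of_int (c' k)) = (\<Sum>k\<in>I - {i} - {j}. g k * of_int (c k))"
        by (rule sum.cong) (simp_all only: old)
      then have "(\<Sum>k\<in>I. h k * of_int (c' k)) = (\<Sum>k\<in>I. g k * of_int (c k))"
        unfolding rest new by (simp add: algebra_simps)
      then show ?thesis using less.prems by simp
    qed
    moreover have "\<exists>k\<in>I. c' k \<noteq> 0" using ij by (auto simp: c'_def intro!: bexI[of _ j])
    ultimately have "\<exists>h'. \<exists>i\<in>I. int_span (I - {i}) h' = int_span I h" by (rule less.hyps)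
    moreover have "int_span I h = int_span I g" unfolding h_def by (rule int_span_shear[OF I ij(1-3)])
    ultimately show ?thesis by simp
  qed
qed

text \<open>
  A generating family of least size satisfies no relation, because a relation would make one
  generator redundant.
\<close>

lemma int_span_has_basis:
  fixes g :: "'i \<Rightarrow> 'k::field_char_0"
  assumes "finite I"
  obtains J :: "'i set" and h :: "'i \<Rightarrow> 'k::field_char_0" where "finite J" "int_span J h = int_span I g"
    "\<forall>c. (\<Sum>i\<in>J. h i * of_int (c i)) = 0 \<longrightarrow> (\<forall>i\<in>J. c i = 0)"
proof -
  define Q :: "'i set \<times> ('i \<Rightarrow> 'k) \<Rightarrow> bool" where "Q = (\<lambda>(J, h). finite J \<and> int_span J h = int_span I g)"
  define m where "m = arg_min (\<lambda>(J, h). card J) Q"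
  have m: "Q m \<and> (\<forall>y. Q y \<longrightarrow> (\<lambda>(J, h). card J) m \<le> (\<lambda>(J, h). card J) y)"
    unfolding m_def using assms by (intro arg_min_nat_lemma[of Q "(I, g)"]) (simp add: Q_def)
  obtain J h where Jh: "m = (J, h)" by (cases m)
  have J: "finite J" "int_span J h = int_span I g" using m by (simp_all add: Jh Q_def)
  have min: "card J \<le> card J'" if "finite J'" "int_span J' h' = int_span I g" for J' :: "'i set" and h' :: "'i \<Rightarrow> 'k"
  proof -
    have "Q (J', h')" using that by (simp add: Q_def)
    then show ?thesis using m by (auto simp: Jh)
  qed
  have *: "c i = 0" if rel: "(\<Sum>i\<in>J. h i * of_int (c i)) = 0" and i: "i \<in> J" for c i
  proof (rule ccontr)
    assume ci: "c i \<noteq> 0"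
    then obtain h' j where h': "j \<in> J" "int_span (J - {j}) h' = int_span J h"
      using redundant_generator[OF J(1) rel] i ci by blast
    then have "card J \<le> card (J - {j})" using J by (intro min) auto
    then show False using card_Diff1_less[OF J(1) h'(1)] by simp
  qed
  show ?thesis by (rule that[OF J]) (use * in blast)
qed

lemma common_denominator:
  fixes u :: "'i \<Rightarrow> rat"
  assumes "finite A"
  obtains N :: int and c where "N > 0" "\<And>i. i \<in> A \<Longrightarrow> of_int N * u i = of_int (c i)"
proof -
  have "\<exists>N>0::int. \<forall>i\<in>A. of_int N * u i \<in> \<int>" using assms
  proof (induction A)
    case (insert i A)
    then obtain N where N: "N > 0" "\<forall>i\<in>A. of_int N * u i \<in> \<int>" by blast
    obtain a b where ab: "u i = Rat.Fract a b" "b > 0" by (cases "u i") auto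
    have "of_int (b * N) * u j \<in> \<int>" if "j \<in> insert i A" for j
    proof (cases "j = i")
      case True
      have "of_int (b * N) * u i = of_int (N * a)" using ab by (simp add: Fract_of_int_quotient)
      then show ?thesis by (simp only: True Ints_of_int)
    next
      case False
      then have "of_int N * u j \<in> \<int>" using N that by blast
      then have "of_int b * (of_int N * u j) \<in> \<int>" by (rule Ints_mult[OF Ints_of_int])
      then show ?thesis by (simp add: mult.assoc)
    qed
    then show ?case using N ab by (intro exI[of _ "b * N"]) auto
  qed (auto intro: exI[of _ 1])
  then obtain N :: int where N: "N > 0" "\<And>i. i \<in> A \<Longrightarrow> of_int N * u i \<in> \<int>" by blast
  have "of_int N * u i = of_int \<lfloor>of_int N * u i\<rfloor>" if "i \<in> A" for i
    using N(2)[OF that] by (elim Ints_cases) simp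
  then show ?thesis using that[of N "\<lambda>i. \<lfloor>of_int N * u i\<rfloor>"] N(1) by blast
qed

text \<open>
  If \<open>\<Sum> a\<^sub>i x\<^sup>i = 0\<close> with \<open>a\<^sub>D = 1\<close> and \<open>N\<close> is a common denominator of the \<open>a\<^sub>i\<close>, then \<open>N x\<close> is a root of
  the monic polynomial with coefficients \<open>N\<^sup>D\<^sup>-\<^sup>i a\<^sub>i\<close>, which are integers.
\<close>

lemma algebraic_int_multiple:
  fixes x :: "'k::field_char_0"
  assumes "p \<noteq> 0" "rpoly p x = 0"
  obtains N :: int where "N > 0" "algebraic_int (of_int N * x)"
proof -
  define D where "D = Polynomial.degree p"
  define a where "a i = Polynomial.coeff p i / Polynomial.lead_coeff p" for i
  have aD: "a D = 1" using assms(1) by (simp add: a_def D_def)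
  have "(\<Sum>i\<le>D. of_rat (a i) * x ^ i) = rpoly (Polynomial.smult (1 / Polynomial.lead_coeff p) p) x"
    by (subst rpoly_altdef_le[of _ D]) (simp_all add: D_def a_def)
  then have a: "(\<Sum>i\<le>D. of_rat (a i) * x ^ i) = 0" using assms(2) by simp
  obtain N :: int and c where N: "N > 0" "\<And>i. i \<in> {..D} \<Longrightarrow> of_int N * a i = of_int (c i)"
    using common_denominator[of "{..D}" a] by auto
  \<comment> \<open>For \<open>i < D\<close> the exponent is \<open>D - i - 1\<close> because \<open>c i\<close> already contains one factor \<open>N\<close>.\<close>
  define e where "e i = (if i < D then c i * N ^ (D - Suc i) else 1)" for i
  have e: "of_int (e i) = (of_int N ^ (D - i) * a i :: rat)" if "i \<le> D" for i
  proof (cases "i < D")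
    case True
    then have "D - i = Suc (D - Suc i)" by simp
    then show ?thesis using True N(2)[of i] by (simp add: e_def algebra_simps flip: N(2))
  next
    case False
    then show ?thesis using that aD by (simp add: e_def)
  qed
  define P :: "'k poly" where "P = (\<Sum>i\<le>D. Polynomial.monom (of_int (e i)) i)"
  have cP: "Polynomial.coeff P i = (if i \<le> D then of_int (e i) else 0)" for i
    by (simp add: P_def coeff_sum)
  have "Polynomial.degree P = D"
    by (rule antisym[OF degree_le le_degree]) (auto simp: cP e_def)
  then have "Polynomial.lead_coeff P = 1" by (simp add: cP e_def)
  moreover have "Polynomial.coeff P i \<in> \<int>" for i by (simp add: cP)
  moreover have "poly P (of_int N * x) = 0"
  proof -
    have "of_int (e i) * (of_int N * x) ^ i = of_int N ^ D * (of_rat (a i) * x ^ i)" if "i \<le> D" for i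
    proof -
      have "(of_int (e i) :: 'k) = of_rat (of_int (e i))" by simp
      also have "\<dots> = of_int N ^ (D - i) * of_rat (a i)"
        unfolding e[OF that] by (simp add: of_rat_mult of_rat_power)
      finally have "of_int (e i) * (of_int N * x) ^ i = (of_int N ^ (D - i) * of_int N ^ i) * (of_rat (a i) * x ^ i)"
        by (simp add: power_mult_distrib mult_ac)
      also have "of_int N ^ (D - i) * of_int N ^ i = (of_int N ^ D :: 'k)"
        using that by (simp flip: power_add)
      finally show ?thesis .
    qed
    then have "poly P (of_int N * x) = (\<Sum>i\<le>D. of_int N ^ D * (of_rat (a i) * x ^ i))"
      by (simp add: P_def poly_sum poly_monom)
    then show ?thesis using a by (simp flip: sum_distrib_left)
  qed
  ultimately show ?thesis using that N(1) by (intro that[of N] algebraic_int.intros[of P]) auto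
qed

lemma span_ring_of_integers:
  assumes "number_field TYPE('k::field_char_0)"
  shows "rat_vs.span (ring_of_integers :: 'k set) = UNIV"
proof (intro equalityI subsetI UNIV_I)
  fix x :: 'k
  obtain p where "p \<noteq> 0" "rpoly p x = 0" using number_field_algebraic[OF assms] by blast
  then obtain N :: int where N: "N > 0" "algebraic_int (of_int N * x)" by (rule algebraic_int_multiple)
  then have "of_rat (1 / of_int N) * (of_int N * x) \<in> rat_vs.span ring_of_integers"
    by (intro rat_vs.span_scale rat_vs.span_base) (simp add: ring_of_integers_def)
  moreover have "of_rat (1 / of_int N) * (of_int N * x) = x" using N(1) by (simp add: of_rat_divide)
  ultimately show "x \<in> rat_vs.span ring_of_integers" by simp
qed

lemma int_span_subset_span:
  assumes "\<And>i. i \<in> I \<Longrightarrow> g i \<in> S"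
  shows "int_span I g \<subseteq> rat_vs.span S"
proof
  fix x assume "x \<in> int_span I g"
  then obtain c where "x = (\<Sum>i\<in>I. g i * of_int (c i))" by (auto simp: int_span_def)
  then have "x = (\<Sum>i\<in>I. of_rat (of_int (c i)) * g i)" by (simp add: mult.commute)
  then show "x \<in> rat_vs.span S"
    by (simp only:) (intro rat_vs.span_sum rat_vs.span_scale rat_vs.span_base assms)
qed

text \<open>
  A relation with rational coefficients becomes one with integer coefficients after
  multiplication by a common denominator. So an integrally independent generating family of the
  integers is also a basis of the field over the rationals, and its size is the degree.
\<close>

theorem integral_basis_exists:
  fixes g :: "'i \<Rightarrow> 'k::field_char_0"
  assumes K: "number_field TYPE('k)" and I: "finite I" "(ring_of_integers :: 'k set) = int_span I g"
  obtains w :: "nat \<Rightarrow> 'k::field_char_0" where "integral_basis w"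
proof -
  obtain J :: "'i set" and h :: "'i \<Rightarrow> 'k" where J: "finite J" "int_span J h = int_span I g"
    and indep': "\<forall>c. (\<Sum>i\<in>J. h i * of_int (c i)) = 0 \<longrightarrow> (\<forall>i\<in>J. c i = 0)"
    by (rule int_span_has_basis[OF I(1), of g])
  note J = J(1) J(2)[folded I(2)]
  have indep: "c i = 0" if "(\<Sum>i\<in>J. h i * of_int (c i)) = 0" "i \<in> J" for c i
    using indep' that by blast
  have inj: "inj_on h J"
  proof (rule inj_onI, rule ccontr)
    fix i j assume ij: "i \<in> J" "j \<in> J" "h i = h j" "i \<noteq> j"
    define c :: "'i \<Rightarrow> int" where "c = (\<lambda>_. 0)(i := 1, j := - 1)"
    have "(\<Sum>k\<in>J. h k * of_int (c k)) = (\<Sum>k\<in>{i, j}. h k * of_int (c k))"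
      using J ij by (intro sum.mono_neutral_right) (auto simp: c_def)
    also have "\<dots> = 0" using ij by (simp add: c_def)
    finally have "c i = 0" using ij(1) by (rule indep)
    then show False using ij by (simp add: c_def)
  qed
  have "rat_vs.independent (h ` J)"
  proof (rule rat_vs.independent_if_scalars_zero)
    show "finite (h ` J)" using J by simp
    fix u :: "'k \<Rightarrow> rat" and x assume *: "(\<Sum>x\<in>h ` J. of_rat (u x) * x) = 0" "x \<in> h ` J"
    obtain N :: int and c where N: "N > 0" "\<And>i. i \<in> J \<Longrightarrow> of_int N * u (h i) = of_int (c i)"
      using common_denominator[OF J(1), of "\<lambda>i. u (h i)"] by auto
    have "of_int (c i) = (of_int N * of_rat (u (h i)) :: 'k)" if "i \<in> J" for i
      using arg_cong[OF N(2)[OF that], of of_rat, symmetric] by (simp add: of_rat_mult)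
    then have "(\<Sum>i\<in>J. h i * of_int (c i)) = (\<Sum>i\<in>J. of_int N * (of_rat (u (h i)) * h i))"
      by (intro sum.cong) auto
    also have "\<dots> = of_int N * (\<Sum>x\<in>h ` J. of_rat (u x) * x)"
      using inj by (simp add: sum.reindex sum_distrib_left)
    finally have rel: "(\<Sum>i\<in>J. h i * of_int (c i)) = 0" using *(1) by simp
    obtain i where i: "i \<in> J" "x = h i" using *(2) by blast
    have "of_int N * u (h i) = 0" using N(2)[OF i(1)] indep[OF rel i(1)] by simp
    then show "u x = 0" using N(1) i by simp
  qed
  moreover have "UNIV \<subseteq> rat_vs.span (h ` J)"
  proof -
    have "int_span J h \<subseteq> rat_vs.span (h ` J)" by (rule int_span_subset_span) blast
    then have "rat_vs.span (int_span J h) \<subseteq> rat_vs.span (h ` J)"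
      by (rule rat_vs.span_minimal) (rule rat_vs.subspace_span)
    then show ?thesis unfolding J(2) span_ring_of_integers[OF K] .
  qed
  ultimately have card: "card J = field_degree TYPE('k)"
    unfolding field_degree_def
    by (intro rat_vs.dim_unique[symmetric, of "h ` J"]) (simp_all add: card_image[OF inj])
  obtain f where f: "bij_betw f {..<field_degree TYPE('k)} J"
    using ex_bij_betw_nat_finite[OF J(1)] unfolding atLeast0LessThan card by blast
  define w where "w = h \<circ> f"
  have inv: "inv_into {..<field_degree TYPE('k)} f (f j) = j" if "j < field_degree TYPE('k)" for j
    using f that by (simp add: bij_betw_def)
  have sum: "(\<Sum>j<field_degree TYPE('k). w j * of_int (c (f j))) = (\<Sum>i\<in>J. h i * of_int (c i))" for c
    unfolding w_def using sum.reindex_bij_betw[OF f, of "\<lambda>i. h i * of_int (c i)"] by simp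
  have sum': "(\<Sum>j<field_degree TYPE('k). w j * of_int (c j))
      = (\<Sum>i\<in>J. h i * of_int (c (inv_into {..<field_degree TYPE('k)} f i)))" for c
    using sum[of "\<lambda>i. c (inv_into {..<field_degree TYPE('k)} f i)"] by (simp add: inv)
  have "integral_basis w" unfolding integral_basis_def
  proof (intro conjI allI impI)
    show "int_span {..<field_degree TYPE('k)} w = ring_of_integers"
      unfolding J(2)[symmetric]
    proof (intro equalityI int_span_minimal)
      fix j assume "j \<in> {..<field_degree TYPE('k)}"
      then show "w j \<in> int_span J h"
        unfolding w_def comp_def by (intro int_span_base J(1) bij_betwE[OF f, rule_format])
    next
      fix i assume "i \<in> J"
      then obtain j where "j < field_degree TYPE('k)" "i = f j" using f by (auto simp: bij_betw_def)
      then show "h i \<in> int_span {..<field_degree TYPE('k)} w"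
        using int_span_base[of "{..<field_degree TYPE('k)}" j w] by (simp add: w_def)
    qed
    fix c :: "nat \<Rightarrow> int" and j
    assume rel: "(\<Sum>j<field_degree TYPE('k). w j * of_int (c j)) = 0" and j: "j < field_degree TYPE('k)"
    have "f j \<in> J" using f j by (auto simp: bij_betw_def)
    from indep[OF rel[unfolded sum'] this] show "c j = 0" using inv[OF j] by simp
  qed
  then show ?thesis by (rule that)
qed

section \<open>Determinants of conjugates\<close>

text \<open>
  For an integral basis and the list of all embeddings, its square is the discriminant.
\<close>

definition conj_det :: "nat \<Rightarrow> ('k \<Rightarrow> complex) list \<Rightarrow> (nat \<Rightarrow> 'k) \<Rightarrow> complex" where
  "conj_det d \<sigma>s b = det (mat d d (\<lambda>(i, j). (\<sigma>s ! i) (b j)))"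

lemma conj_det_base_change:
  fixes \<sigma>s :: "('k::field_char_0 \<Rightarrow> complex) list"
  assumes \<sigma>s: "\<And>i. i < d \<Longrightarrow> \<sigma>s ! i \<in> field_embeddings"
    and y: "\<And>k. k < d \<Longrightarrow> y k = (\<Sum>j<d. x j * of_rat (c j k))"
  shows "conj_det d \<sigma>s y = conj_det d \<sigma>s x * of_rat (det (mat d d (\<lambda>(j, k). c j k)))"
proof -
  define A where "A = mat d d (\<lambda>(i, j). (\<sigma>s ! i) (x j))"
  define C :: "complex mat" where "C = map_mat of_rat (mat d d (\<lambda>(j, k). c j k))"
  have entry: "(\<sigma>s ! i) (y k) = (\<Sum>j<d. (\<sigma>s ! i) (x j) * of_rat (c j k))" if "i < d" "k < d" for i k
    using y[OF that(2)] \<sigma>s[OF that(1)] by (simp add: embedding_sum embedding_mult embedding_of_rat)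
  have "mat d d (\<lambda>(i, j). (\<sigma>s ! i) (y j)) = A * C"
    by (rule eq_matI) (simp_all add: A_def C_def scalar_prod_def entry atLeast0LessThan)
  then have "conj_det d \<sigma>s y = det (A * C)" by (simp add: conj_det_def)
  also have "\<dots> = det A * det C" by (rule det_mult[of _ d]) (simp_all add: A_def C_def)
  also have "det C = of_rat (det (mat d d (\<lambda>(j, k). c j k)))" unfolding C_def by (rule of_rat_hom.hom_det)
  finally show ?thesis by (simp add: conj_det_def A_def)
qed

lemma conj_det_int_span:
  fixes \<sigma>s :: "('k::field_char_0 \<Rightarrow> complex) list"
  assumes \<sigma>s: "\<And>i. i < d \<Longrightarrow> \<sigma>s ! i \<in> field_embeddings"
    and y: "\<And>k. k < d \<Longrightarrow> y k \<in> int_span {..<d} w"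
  obtains N :: int where "conj_det d \<sigma>s y = conj_det d \<sigma>s w * of_int N"
proof -
  have "\<forall>k. \<exists>c::nat \<Rightarrow> int. k < d \<longrightarrow> y k = (\<Sum>j<d. w j * of_int (c j))"
    using y by (fastforce simp: int_span_def)
  then obtain c :: "nat \<Rightarrow> nat \<Rightarrow> int" where c: "\<And>k. k < d \<Longrightarrow> y k = (\<Sum>j<d. w j * of_int (c k j))"
    by metis
  have "mat d d (\<lambda>(j, k). rat_of_int (c k j)) = map_mat of_int (mat d d (\<lambda>(j, k). c k j))"
    by (rule eq_matI) simp_all
  then have "det (mat d d (\<lambda>(j, k). rat_of_int (c k j))) = of_int (det (mat d d (\<lambda>(j, k). c k j)))"
    by (simp only: of_int_hom.hom_det)
  moreover have "conj_det d \<sigma>s y = conj_det d \<sigma>s w * of_rat (det (mat d d (\<lambda>(j, k). rat_of_int (c k j))))"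
    by (rule conj_det_base_change[OF \<sigma>s]) (simp_all add: c)
  ultimately show ?thesis by (intro that[of "det (mat d d (\<lambda>(j, k). c k j))"]) simp
qed

text \<open>
  This is Cramer's rule: the new column is the matrix applied to the vector of the \<open>r j\<close>.
\<close>

lemma conj_det_replace:
  fixes \<sigma>s :: "('k::field_char_0 \<Rightarrow> complex) list"
  assumes \<sigma>s: "\<And>i. i < d \<Longrightarrow> \<sigma>s ! i \<in> field_embeddings" and t: "t < d"
  shows "conj_det d \<sigma>s (b(t := \<Sum>j<d. of_rat (r j) * b j)) = of_rat (r t) * conj_det d \<sigma>s b"
proof -
  define A where "A = mat d d (\<lambda>(i, j). (\<sigma>s ! i) (b j))"
  define x :: "complex vec" where "x = vec d (\<lambda>j. of_rat (r j))"
  have entry: "(\<sigma>s ! i) (\<Sum>j<d. of_rat (r j) * b j) = (\<Sum>j<d. (\<sigma>s ! i) (b j) * of_rat (r j))" if "i < d" for i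
    using \<sigma>s[OF that] by (simp add: embedding_sum embedding_mult embedding_of_rat mult.commute)
  have "mat d d (\<lambda>(i, j). (\<sigma>s ! i) ((b(t := \<Sum>j<d. of_rat (r j) * b j)) j)) = replace_col A (A *\<^sub>v x) t"
    by (rule eq_matI) (auto simp: A_def x_def replace_col_def scalar_prod_def entry atLeast0LessThan)
  moreover have "det (replace_col A (A *\<^sub>v x) t) = x $ t * det A"
    by (rule cramer_lemma_mat[OF _ _ t]) (simp_all add: A_def x_def)
  ultimately show ?thesis using t by (simp add: conj_det_def A_def x_def)
qed

text \<open>
  Each of the \<open>d!\<close> terms of the Leibniz formula takes one entry from every row.
\<close>

lemma conj_det_bound:
  assumes "\<And>i j. i < d \<Longrightarrow> j < d \<Longrightarrow> cmod ((\<sigma>s ! i) (b j)) \<le> M i"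
  shows "cmod (conj_det d \<sigma>s b) \<le> fact d * (\<Prod>i<d. M i)"
proof -
  define A where "A = mat d d (\<lambda>(i, j). (\<sigma>s ! i) (b j))"
  have "conj_det d \<sigma>s b = (\<Sum>p\<in>{p. p permutes {0..<d}}. signof p * (\<Prod>i = 0..<d. A $$ (i, p i)))"
    unfolding conj_det_def A_def by (rule det_def') simp
  also have "cmod \<dots> \<le> (\<Sum>p\<in>{p. p permutes {0..<d}}. \<Prod>i<d. M i)"
  proof (rule sum_norm_le)
    fix p assume "p \<in> {p. p permutes {0..<d}}"
    then have p: "p permutes {0..<d}" by simp
    have "cmod (signof p) = 1" by (simp add: sign_def)
    then have "cmod (signof p * (\<Prod>i = 0..<d. A $$ (i, p i))) = (\<Prod>i<d. cmod (A $$ (i, p i)))"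
      by (simp add: norm_mult prod_norm atLeast0LessThan)
    also have "\<dots> \<le> (\<Prod>i<d. M i)"
    proof (rule prod_mono)
      fix i assume "i \<in> {..<d}"
      moreover from this have "p i < d" using permutes_in_image[OF p, of i] by simp
      ultimately show "0 \<le> cmod (A $$ (i, p i)) \<and> cmod (A $$ (i, p i)) \<le> M i"
        using assms by (simp add: A_def)
    qed
    finally show "cmod (signof p * (\<Prod>i = 0..<d. A $$ (i, p i))) \<le> (\<Prod>i<d. M i)" .
  qed
  also have "\<dots> = fact d * (\<Prod>i<d. M i)" by (simp add: card_permutations[of "{0..<d}" d])
  finally show ?thesis .
qed

section \<open>Cones\<close>

text \<open>
  As long as the vectors are dependent, moving the coefficients along a relation until the first
  one vanishes removes a vector and keeps all coefficients nonnegative.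
\<close>

lemma rational_caratheodory:
  fixes T :: "'k::field_char_0 set"
  assumes "finite T" "x = (\<Sum>t\<in>T. of_rat (q t) * t)" "\<And>t. t \<in> T \<Longrightarrow> q t \<ge> 0"
  shows "\<exists>S q'. S \<subseteq> T \<and> rat_vs.independent S \<and> (\<forall>t\<in>S. q' t \<ge> 0) \<and> x = (\<Sum>t\<in>S. of_rat (q' t) * t)"
  using assms
proof (induction "card T" arbitrary: T q rule: less_induct)
  case less
  show ?case
  proof (cases "rat_vs.independent T")
    case True
    then show ?thesis using less.prems by blast
  next
    case False
    then obtain u where u: "\<exists>t\<in>T. u t \<noteq> 0" "(\<Sum>t\<in>T. of_rat (u t) * t) = 0"
      using rat_vs.dependent_finite[OF less.prems(1)] by blast
    have "\<exists>u. (\<exists>t\<in>T. u t > 0) \<and> (\<Sum>t\<in>T. of_rat (u t) * t) = 0"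
    proof (cases "\<exists>t\<in>T. u t > 0")
      case False
      then have "\<exists>t\<in>T. - u t > 0" using u(1) by (auto simp: not_less intro: less_le[THEN iffD2])
      moreover have "(\<Sum>t\<in>T. of_rat (- u t) * t) = 0" using u(2) by (simp add: of_rat_minus sum_negf)
      ultimately show ?thesis by (intro exI[of _ "\<lambda>t. - u t"] conjI)
    qed (use u in blast)
    then obtain u where u: "\<exists>t\<in>T. u t > 0" "(\<Sum>t\<in>T. of_rat (u t) * t) = 0" by blast
    define P where "P = {t \<in> T. u t > 0}"
    \<comment> \<open>The coefficient of \<open>t0\<close> is the first to vanish in \<open>q t - l * u t\<close> as \<open>l\<close> grows from \<open>0\<close>.\<close>
    define t0 where "t0 = arg_min_on (\<lambda>t. q t / u t) P"
    have P: "finite P" "P \<noteq> {}" using less.prems(1) u(1) by (auto simp: P_def)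
    have t0: "t0 \<in> T" "u t0 > 0" using arg_min_if_finite(1)[OF P] by (auto simp: t0_def P_def)
    define l where "l = q t0 / u t0"
    have l0: "l \<ge> 0" using less.prems(3)[OF t0(1)] t0(2) by (simp add: l_def)
    define q' where "q' t = q t - l * u t" for t
    have q': "q' t \<ge> 0" if "t \<in> T" for t
    proof (cases "u t > 0")
      case True
      then have "l \<le> q t / u t"
        using arg_min_least[OF P, of t "\<lambda>t. q t / u t"] that by (simp add: l_def t0_def P_def)
      then show ?thesis using True by (simp add: q'_def field_simps)
    next
      case False
      then have "l * u t \<le> 0" using l0 by (simp add: mult_nonneg_nonpos)
      then show ?thesis using less.prems(3)[OF that] by (simp add: q'_def)
    qed
    have "q' t0 = 0" using t0 by (simp add: q'_def l_def)
    have "(\<Sum>t\<in>T. of_rat (q' t) * t) = x - of_rat l * (\<Sum>t\<in>T. of_rat (u t) * t)"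
      unfolding less.prems(2) sum_distrib_left sum_subtractf[symmetric]
      by (simp add: q'_def of_rat_diff of_rat_mult algebra_simps)
    then have "x = (\<Sum>t\<in>T - {t0}. of_rat (q' t) * t)"
      using u(2) sum.remove[OF less.prems(1) t0(1), of "\<lambda>t. of_rat (q' t) * t"] \<open>q' t0 = 0\<close> by simp
    moreover have "card (T - {t0}) < card T" using less.prems(1) t0(1) by (rule card_Diff1_less)
    ultimately have "\<exists>S q'. S \<subseteq> T - {t0} \<and> rat_vs.independent S \<and> (\<forall>t\<in>S. q' t \<ge> 0) \<and> x = (\<Sum>t\<in>S. of_rat (q' t) * t)"
      using less.prems(1) q' by (intro less.hyps[of "T - {t0}" q']) auto
    then show ?thesis by blast
  qed
qed

lemma Sg_add: "x \<in> Sg n a \<Longrightarrow> y \<in> Sg n a \<Longrightarrow> x + y \<in> Sg n a"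
  unfolding Sg_def
proof clarify
  fix x y :: "nat \<Rightarrow> nat"
  show "\<exists>z. (\<Sum>i = 1..n. a i * of_nat (x i)) + (\<Sum>i = 1..n. a i * of_nat (y i))
      = (\<Sum>i = 1..n. a i * of_nat (z i)) \<and> True"
    by (rule exI[of _ "\<lambda>i. x i + y i"]) (simp add: sum.distrib algebra_simps)
qed

lemma Sg_0: "0 \<in> Sg n a"
  unfolding Sg_def by (rule CollectI, rule exI[of _ "\<lambda>_. 0"]) simp

lemma Sg_generator:
  assumes "t \<in> a ` {1..n}"
  shows "of_nat m * t \<in> Sg n a"
proof -
  obtain i where i: "i \<in> {1..n}" "t = a i" using assms by blast
  have "(\<Sum>j = 1..n. a j * of_nat (if j = i then m else 0)) = (\<Sum>j = 1..n. if j = i then of_nat m * a j else 0)"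
    by (rule sum.cong) auto
  also have "\<dots> = of_nat m * t" using i by (simp add: sum.delta)
  finally have "of_nat m * t = (\<Sum>j = 1..n. a j * of_nat (if j = i then m else 0))" by (rule sym)
  then show ?thesis unfolding Sg_def by (intro CollectI exI[of _ "\<lambda>j. if j = i then m else 0"]) simp
qed

lemma Sg_sum: "(\<And>j. j \<in> J \<Longrightarrow> f j \<in> Sg n a) \<Longrightarrow> (\<Sum>j\<in>J. f j) \<in> Sg n a"
  by (induction J rule: infinite_finite_induct) (auto simp: Sg_0 Sg_add)

text \<open>
  Coefficients are indexed by values rather than by positions, since the entries of \<open>a\<close> need not
  be distinct.
\<close>

lemma rat_cone_merge:
  assumes "x \<in> rat_cone n a"
  obtains q where "x = (\<Sum>t\<in>a ` {1..n}. of_rat (q t) * t)" "\<forall>t. q t \<ge> 0"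
proof -
  obtain c where c: "x = (\<Sum>i = 1..n. a i * of_rat (c i))" "\<forall>i\<in>{1..n}. c i \<ge> 0"
    using assms by (auto simp: rat_cone_def)
  define q where "q t = (\<Sum>i\<in>{i \<in> {1..n}. a i = t}. c i)" for t
  have "x = (\<Sum>t\<in>a ` {1..n}. \<Sum>i\<in>{i \<in> {1..n}. a i = t}. a i * of_rat (c i))"
    unfolding c(1) by (rule sum.image_gen) simp
  also have "\<dots> = (\<Sum>t\<in>a ` {1..n}. of_rat (q t) * t)"
    unfolding q_def of_rat_sum sum_distrib_right by (intro sum.cong) (auto simp: mult.commute)
  finally have x: "x = (\<Sum>t\<in>a ` {1..n}. of_rat (q t) * t)" .
  have "\<forall>t. q t \<ge> 0" unfolding q_def using c(2) by (intro allI sum_nonneg) simp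
  with x show ?thesis by (rule that)
qed

lemma Sg_subset:
  assumes "ring_of_integers = int_span {1..n} a"
  shows "Sg n a \<subseteq> rat_cone n a \<inter> ring_of_integers"
proof
  fix x assume "x \<in> Sg n a"
  then obtain m :: "nat \<Rightarrow> nat" where m: "x = (\<Sum>i = 1..n. a i * of_nat (m i))" by (auto simp: Sg_def)
  have "x = (\<Sum>i = 1..n. a i * of_rat (of_nat (m i)))" by (simp add: m)
  then have "x \<in> rat_cone n a" unfolding rat_cone_def
    by (intro CollectI exI[of _ "\<lambda>i. of_nat (m i)"]) simp
  moreover have "x \<in> int_span {1..n} a" unfolding int_span_def m
    by (intro CollectI exI[of _ "\<lambda>i. int (m i)"]) simp
  ultimately show "x \<in> rat_cone n a \<inter> ring_of_integers" using assms by simp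
qed


section \<open>The lower bound for the height\<close>

text \<open>
  The factor \<open>2\<close> measures the failure of the semigroup to contain all integers of its cone. A
  point \<open>x\<close> of the cone that the semigroup misses has, in some basis \<open>b\<close> consisting of generators, a
  coordinate \<open>r t\<close> that is not an integer. Reducing all coordinates of \<open>x\<close> modulo \<open>1\<close> gives an integer
  \<open>y\<close> of the field. Exchanging \<open>b t\<close> for \<open>y\<close> multiplies the determinant by \<open>frac (r t)\<close>, which
  turns a multiple \<open>N\<close> of the determinant of \<open>w\<close> into a smaller nonzero multiple.
\<close>

lemma large_conj_det:
  fixes \<alpha> :: "nat \<Rightarrow> 'k::field_char_0" and \<sigma>s :: "('k \<Rightarrow> complex) list"
  assumes K: "number_field TYPE('k)" and d: "d = field_degree TYPE('k)"
    and \<sigma>s: "\<And>i. i < d \<Longrightarrow> \<sigma>s ! i \<in> field_embeddings"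
    and O: "(ring_of_integers :: 'k set) = int_span {1..n} \<alpha>"
    and ne: "Sg n \<alpha> \<noteq> rat_cone n \<alpha> \<inter> ring_of_integers"
    and w: "integral_basis w" and w0: "conj_det d \<sigma>s w \<noteq> 0"
  obtains b where "\<And>k. k < d \<Longrightarrow> b k \<in> \<alpha> ` {1..n}" "2 * cmod (conj_det d \<sigma>s w) \<le> cmod (conj_det d \<sigma>s b)"
proof -
  define T where "T = \<alpha> ` {1..n}"
  obtain x where x: "x \<in> rat_cone n \<alpha>" "x \<in> ring_of_integers" "x \<notin> Sg n \<alpha>"
    using ne Sg_subset[OF O] by blast
  obtain q where q: "x = (\<Sum>t\<in>T. of_rat (q t) * t)" "\<forall>t. q t \<ge> 0"
    unfolding T_def by (rule rat_cone_merge[OF x(1)])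
  have "finite T" by (simp add: T_def)
  from rational_caratheodory[OF this q(1)] q(2) obtain S q' where S: "S \<subseteq> T" "rat_vs.independent S"
    and q': "\<forall>t\<in>S. q' t \<ge> 0" "x = (\<Sum>t\<in>S. of_rat (q' t) * t)" by blast
  \<comment> \<open>The generators needed for \<open>x\<close> are completed to a basis; the added ones get coefficient \<open>0\<close>.\<close>
  obtain B where B: "S \<subseteq> B" "B \<subseteq> T" "rat_vs.independent B" "T \<subseteq> rat_vs.span B"
    by (rule rat_vs.maximal_independent_subset_extend[OF S])
  have finB: "finite B" using B(2) \<open>finite T\<close> by (rule finite_subset)
  have "(ring_of_integers :: 'k set) \<subseteq> rat_vs.span T"
    unfolding O by (rule int_span_subset_span) (simp add: T_def)
  moreover have "rat_vs.span T \<subseteq> rat_vs.span B"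
    by (rule rat_vs.span_minimal[OF B(4) rat_vs.subspace_span])
  ultimately have "(ring_of_integers :: 'k set) \<subseteq> rat_vs.span B" by (rule subset_trans)
  then have "rat_vs.span (ring_of_integers :: 'k set) \<subseteq> rat_vs.span B"
    by (rule rat_vs.span_minimal[OF _ rat_vs.subspace_span])
  then have spanB: "rat_vs.span B = UNIV" unfolding span_ring_of_integers[OF K] by blast
  have "d = card B" unfolding d field_degree_def
    by (rule rat_vs.dim_unique[of B]) (simp_all add: spanB B(3))
  then obtain b where b: "bij_betw b {..<d} B"
    using ex_bij_betw_nat_finite[OF finB] unfolding atLeast0LessThan by blast
  have bT: "b k \<in> T" if "k < d" for k using bij_betwE[OF b] B(2) that by blast
  have bO: "b k \<in> ring_of_integers" if "k < d" for k
    using bT[OF that] int_span_base[of "{1..n}" _ \<alpha>] unfolding O T_def by auto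
  define r where "r k = (if b k \<in> S then q' (b k) else 0)" for k
  have r0: "r k \<ge> 0" for k using q'(1) by (simp add: r_def)
  have "x = (\<Sum>t\<in>B. of_rat (if t \<in> S then q' t else 0) * t)"
    unfolding q'(2) by (rule sum.mono_neutral_cong_left[OF finB B(1)]) auto
  also have "\<dots> = (\<Sum>k<d. of_rat (r k) * b k)"
    unfolding r_def by (rule sum.reindex_bij_betw[OF b, symmetric])
  finally have xr: "x = (\<Sum>k<d. of_rat (r k) * b k)" .
  have "\<exists>t<d. r t \<notin> \<int>"
  proof (rule ccontr)
    assume "\<not> (\<exists>t<d. r t \<notin> \<int>)"
    then have int: "r k \<in> \<int>" if "k < d" for k using that by blast
    have "of_rat (r k) * b k \<in> Sg n \<alpha>" if k: "k < d" for k
    proof -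
      obtain z where z: "r k = of_int z" using int[OF k] by (rule Ints_cases)
      then have "z \<ge> 0" using r0[of k] by simp
      then have "r k = of_nat (nat z)" using z by simp
      then have "of_rat (r k) = (of_nat (nat z) :: 'k)" by simp
      then show ?thesis using Sg_generator[of "b k" \<alpha> n "nat z"] bT[OF k] by (simp only: T_def)
    qed
    then have "x \<in> Sg n \<alpha>" unfolding xr by (intro Sg_sum) simp
    then show False using x(3) by contradiction
  qed
  then obtain t where t: "t < d" "r t \<notin> \<int>" by blast
  define y where "y = (\<Sum>k<d. of_rat (frac (r k)) * b k)"
  have "y = x + (\<Sum>k<d. of_int (- \<lfloor>r k\<rfloor>) * b k)"
    unfolding xr y_def sum.distrib[symmetric]
    by (rule sum.cong) (simp_all add: frac_def of_rat_diff algebra_simps)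
  also have "\<dots> \<in> int_span {1..n} \<alpha>"
    using x(2) bO unfolding O by (intro int_span_add int_span_sum int_span_mult) simp_all
  finally have yO: "y \<in> ring_of_integers" unfolding O .
  have Ow: "(ring_of_integers :: 'k set) = int_span {..<d} w"
    using w by (simp add: integral_basis_def d)
  obtain N where N: "conj_det d \<sigma>s b = conj_det d \<sigma>s w * of_int N"
    by (rule conj_det_int_span[of d \<sigma>s b w]) (use \<sigma>s bO Ow in auto)
  obtain N' where N': "conj_det d \<sigma>s (b(t := y)) = conj_det d \<sigma>s w * of_int N'"
    by (rule conj_det_int_span[of d \<sigma>s "b(t := y)" w]) (use \<sigma>s bO yO Ow in auto)
  have "conj_det d \<sigma>s (b(t := y)) = of_rat (frac (r t)) * conj_det d \<sigma>s b"
    unfolding y_def by (rule conj_det_replace[OF \<sigma>s t(1)])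
  then have "of_int N' = of_rat (frac (r t)) * (of_int N :: complex)" using w0 N N' by simp
  also have "\<dots> = of_rat (frac (r t) * of_int N)" by (simp add: of_rat_mult)
  finally have "complex_of_rat (of_int N') = of_rat (frac (r t) * of_int N)" by simp
  then have NN': "of_int N' = frac (r t) * of_int N" by (simp only: of_rat_eq_iff)
  \<comment> \<open>As \<open>w\<close> is a rational combination of \<open>b\<close>, its determinant would vanish together with that of \<open>b\<close>.\<close>
  have "N \<noteq> 0"
  proof
    assume "N = 0"
    have "\<forall>k. \<exists>u. w k = (\<Sum>v\<in>B. of_rat (u v) * v)"
    proof
      fix k
      have "w k \<in> rat_vs.span B" by (simp add: spanB)
      then show "\<exists>u. w k = (\<Sum>v\<in>B. of_rat (u v) * v)" unfolding rat_vs.span_finite[OF finB] by blast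
    qed
    then obtain u where u: "\<And>k. w k = (\<Sum>v\<in>B. of_rat (u k v) * v)" by metis
    have "w k = (\<Sum>j<d. b j * of_rat (u k (b j)))" for k
      unfolding u[of k] using sum.reindex_bij_betw[OF b, of "\<lambda>v. of_rat (u k v) * v"]
      by (simp add: mult.commute)
    then have "conj_det d \<sigma>s w = conj_det d \<sigma>s b * of_rat (det (mat d d (\<lambda>(j, k). u k (b j))))"
      by (intro conj_det_base_change[OF \<sigma>s])
    then show False using N \<open>N = 0\<close> w0 by simp
  qed
  have f: "frac (r t) > 0" "frac (r t) < 1" using t(2) by (simp_all add: frac_gt_0_iff frac_lt_1)
  have "\<bar>N\<bar> \<ge> 2"
  proof -
    have "rat_of_int \<bar>N'\<bar> = frac (r t) * of_int \<bar>N\<bar>"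
      using f(1) arg_cong[OF NN', of abs] by (simp add: abs_mult)
    moreover have "0 < frac (r t) * of_int \<bar>N\<bar>" using f(1) \<open>N \<noteq> 0\<close> by simp
    moreover have "frac (r t) * of_int \<bar>N\<bar> < 1 * of_int \<bar>N\<bar>"
      using f(2) \<open>N \<noteq> 0\<close> by (intro mult_strict_right_mono) simp_all
    ultimately have "0 < rat_of_int \<bar>N'\<bar>" "rat_of_int \<bar>N'\<bar> < of_int \<bar>N\<bar>" by simp_all
    then have "0 < \<bar>N'\<bar>" "\<bar>N'\<bar> < \<bar>N\<bar>" by (simp_all only: of_int_less_iff of_int_0_less_iff)
    then show ?thesis by linarith
  qed
  then have "2 \<le> cmod (of_int N)" by (simp add: norm_of_int)
  then have "2 * cmod (conj_det d \<sigma>s w) \<le> cmod (conj_det d \<sigma>s b)"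
    unfolding N norm_mult by (subst mult.commute) (intro mult_left_mono norm_ge_zero)
  with bT[unfolded T_def] show ?thesis by (rule that)
qed

text \<open>
  With \<open>m = n - d - 1\<close>, combine \<open>\<surd>(m + 2) \<le> 2 (m + 1)\<close> with the integrality of the binomial
  coefficient \<open>n! / (d! (m + 1)!)\<close>.
\<close>

lemma factorial_bound:
  assumes "(d::nat) < n"
  shows "fact d * sqrt (real (n - d + 1)) * fact (n - d - 1) \<le> 2 * fact n"
proof -
  obtain m where m: "n = d + Suc m" using less_imp_add_positive[OF assms] by (metis Suc_pred)
  have "real m + 2 \<le> (2 * real (Suc m))\<^sup>2" by (simp add: power2_eq_square algebra_simps)
  then have "sqrt (real m + 2) \<le> 2 * real (Suc m)" by (intro real_le_lsqrt) simp_all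
  then have "fact d * sqrt (real m + 2) * fact m \<le> fact d * (2 * real (Suc m)) * fact m"
    by (intro mult_right_mono mult_left_mono) simp_all
  also have "\<dots> = 2 * (fact d * fact (Suc m))" by simp
  also have "(fact d * fact (Suc m) :: nat) \<le> fact n"
    unfolding m by (rule dvd_imp_le[OF fact_fact_dvd_fact fact_gt_zero])
  then have "real (fact d * fact (Suc m)) \<le> real (fact n)" by (rule of_nat_mono)
  then have "2 * (fact d * fact (Suc m)) \<le> (2 * fact n :: real)" by (simp only: of_nat_mult of_nat_fact)
  finally show ?thesis by (simp add: m add.commute)
qed

theorem corollary3p3:
  fixes \<alpha> :: "nat \<Rightarrow> 'k::field_char_0" and n d :: nat
  assumes "number_field TYPE('k)"
    and "totally_real TYPE('k)"
    and "d = field_degree TYPE('k)"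
    and "n > d"
    and "\<And>i. i \<in> {1..n} \<Longrightarrow> \<alpha> i \<in> nonneg_integers \<and> \<alpha> i \<noteq> 0"
    and "(ring_of_integers :: 'k set) = int_span {1..n} \<alpha>"
    and "Sg n \<alpha> \<noteq> rat_cone n \<alpha> \<inter> ring_of_integers"
  shows "weil_height n \<alpha> \<ge>
    (2 * cmod (discriminant TYPE('k)) * sqrt (real (n - d + 1)) * fact (n - d - 1)
       / (fact d * fact n)) powr (1 / (2 * real d))"
proof -
  note K = assms(1) and tr = assms(2) and d = assms(3)
  define E where "E = (field_embeddings :: ('k \<Rightarrow> complex) set)"
  define \<sigma>s where "\<sigma>s = (SOME \<sigma>s. distinct \<sigma>s \<and> set \<sigma>s = E)"
  define w where "w = (SOME w :: nat \<Rightarrow> 'k. integral_basis w)"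
  define D where "D = cmod (conj_det d \<sigma>s w)"
  define H where "H = field_height n \<alpha>"
  have "\<exists>xs. set xs = E \<and> distinct xs"
    using card_complex_embeddings(1)[OF K] unfolding E_def by (rule finite_distinct_list)
  then have "\<exists>xs. distinct xs \<and> set xs = E" by blast
  then have \<sigma>s: "distinct \<sigma>s" "set \<sigma>s = E" unfolding \<sigma>s_def by (rule someI2_ex, simp)+
  have len: "length \<sigma>s = d"
    using distinct_card[OF \<sigma>s(1)] card_complex_embeddings(2)[OF K] by (simp add: \<sigma>s(2) d E_def)
  have emb: "\<sigma>s ! i \<in> field_embeddings" if "i < d" for i
    using nth_mem[of i \<sigma>s] that by (simp add: len \<sigma>s(2) E_def)
  obtain w' :: "nat \<Rightarrow> 'k" where "integral_basis w'"
    by (rule integral_basis_exists[OF K _ assms(6)]) simp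
  then have w: "integral_basis w" unfolding w_def by (rule someI[where P = integral_basis])
  have disc: "cmod (discriminant TYPE('k)) = D\<^sup>2"
    by (simp add: discriminant_def Let_def D_def conj_det_def \<sigma>s_def w_def E_def d norm_power)
  define h where "h \<sigma> = local_height (\<lambda>x. cmod (\<sigma> x)) n \<alpha>" for \<sigma> :: "'k \<Rightarrow> complex"
  have int: "\<alpha> i \<in> ring_of_integers" if "i \<in> {1..n}" for i
    using assms(5)[OF that] by (simp add: nonneg_integers_def)
  have "H = prod h E"
    unfolding H_def h_def E_def by (rule field_height_eq_prod_embeddings[OF K tr int])
  also have "\<dots> = (\<Prod>i<d. h (\<sigma>s ! i))"
    using prod.reindex_bij_betw[OF bij_betw_nth[OF \<sigma>s(1) refl refl], of h] by (simp add: \<sigma>s(2) len)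
  finally have H: "H = (\<Prod>i<d. h (\<sigma>s ! i))" .
  have H1: "H \<ge> 1" unfolding H h_def by (intro prod_ge_1 local_height_ge_1)
  have bound: "2 * D \<le> fact d * H"
  proof (cases "D = 0")
    case False
    then have "conj_det d \<sigma>s w \<noteq> 0" by (simp add: D_def)
    from large_conj_det[OF K d emb assms(6,7) w this]
    obtain b where b: "\<And>k. k < d \<Longrightarrow> b k \<in> \<alpha> ` {1..n}" "2 * D \<le> cmod (conj_det d \<sigma>s b)"
      unfolding D_def by blast
    have "cmod ((\<sigma>s ! i) (b j)) \<le> h (\<sigma>s ! i)" if ij: "i < d" "j < d" for i j
    proof -
      obtain l where l: "l \<in> {1..n}" "b j = \<alpha> l" using b(1)[OF ij(2)] by blast
      have "normalized_abs (\<lambda>x. cmod ((\<sigma>s ! i) x)) (\<alpha> l) \<le> h (\<sigma>s ! i)"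
        unfolding h_def using l(1) by (rule local_height_ge_abs)
      then show ?thesis using local_degree_embedding[OF tr emb[OF ij(1)]] l(2) by (simp add: normalized_abs_def)
    qed
    then have "cmod (conj_det d \<sigma>s b) \<le> fact d * H" unfolding H by (rule conj_det_bound)
    then show ?thesis using b(2) by simp
  qed (use H1 in simp)
  define R where "R = 2 * D\<^sup>2 * sqrt (real (n - d + 1)) * fact (n - d - 1) / (fact d * fact n)"
  have "R \<le> H\<^sup>2"
  proof -
    have "(2 * D)\<^sup>2 \<le> (fact d * H)\<^sup>2" using bound by (rule power_mono) (simp add: D_def)
    then have D2: "4 * D\<^sup>2 \<le> (fact d)\<^sup>2 * H\<^sup>2" by (simp add: power_mult_distrib)
    have "2 * D\<^sup>2 * (sqrt (real (n - d + 1)) * fact (n - d - 1))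
        \<le> (fact d)\<^sup>2 * H\<^sup>2 / 2 * (sqrt (real (n - d + 1)) * fact (n - d - 1))"
      using D2 by (intro mult_right_mono) simp_all
    also have "\<dots> = (fact d * H\<^sup>2 / 2) * (fact d * sqrt (real (n - d + 1)) * fact (n - d - 1))"
      by (simp add: power2_eq_square)
    also have "\<dots> \<le> (fact d * H\<^sup>2 / 2) * (2 * fact n)"
      by (intro mult_left_mono factorial_bound[OF assms(4)]) simp
    finally show ?thesis unfolding R_def by (simp add: field_simps)
  qed
  moreover have "R \<ge> 0" unfolding R_def by simp
  ultimately have "R powr (1 / (2 * real d)) \<le> (H\<^sup>2) powr (1 / (2 * real d))"
    by (intro powr_mono2) simp_all
  also have "H\<^sup>2 = H powr 2" using H1 by simp
  also have "(H powr 2) powr (1 / (2 * real d)) = H powr (1 / real d)" by (simp add: powr_powr)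
  finally show ?thesis unfolding R_def disc weil_height_def H_def d .
qed

end
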